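(* Let $\mathcal X$ and $\mathcal Y$ be compact subsets of $\mathbb R^d$, let $\mathcal Z$ be the conical hull of $\mathcal Y$, and let $$c_2(x,m)=\frac12\left\|x-\int y\,m(dy)\right\|_2^2,\qquad x\in\mathcal X,\ m\in\mathcal M(\mathcal Y),$$ where $\|\cdot\|_2$ is the standard Euclidean norm. Let $\mu\in\mathcal P(\mathcal X)$ and $\nu\in\mathcal P(\mathcal Y)$ be such that the convex hull of the support of $\nu$ does not contain $0$. Then there exists a unique probability measure $\bar\nu\in\mathcal P(\mathcal Z)$ with $\bar\nu\le_{phc}\nu$ such that $$\mathcal I_{c_2}(\mu,\nu)=\frac12\inf_{\eta\le_{phc}\nu}W_2^2(\mu,\eta)=\frac12W_2^2(\mu,\bar\nu).$$ Moreover, there exists a closed convex set $C\subset\mathbb R^d$ such that, for any nonnegative kernel $\bar q$ minimizing $\mathcal I_{c_2}(\mu,\nu)$, one has $$\bar S(x)=\int y\,\bar q^x(dy)=x-p_C(x)\quad\text{for }\mu\text{-almost every }x,$$ where $p_C:\mathbb R^d\to\mathbb R^d$ is the orthogonal projection onto $C$. The probability measure $\bar\nu$ is the image of $\mu$ under the map $x\mapsto x-p_C(x)$.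
   Context: $\mathcal P(E)$: Borel probability measures on $E$; $\mathcal M(\mathcal Y)$: finite nonnegative Borel measures on $\mathcal Y$. The conical hull of $\mathcal Y$ is $\mathcal Z=\{\sum_{i=1}^n\lambda_iy_i:\ n\ge1,\ \lambda_i\ge0,\ y_i\in\mathcal Y\}$. $W_2^2(\mu,\eta)=\inf_{\pi\in\Pi(\mu,\eta)}\iint\|x-z\|_2^2\,\pi(dxdz)$, where $\Pi(\mu,\eta)$ is the set of couplings of $\mu$ and $\eta$. For probability measures $\eta,\nu$ on $\mathbb R^d$ with finite first moments, $\eta\le_{phc}\nu$ means $\int\varphi\,d\eta\le\int\varphi\,d\nu$ for all convex $\varphi:\mathbb R^d\to\mathbb R$ satisfying $\varphi(tx)=t\varphi(x)$ for all $t\ge0$, $x\in\mathbb R^d$. A nonnegative kernel is a family $q=(q^x)_{x\in\mathcal X}$ in $\mathcal M(\mathcal Y)$ with $x\mapsto q^x(A)$ measurable for all Borel $A\subset\mathcal Y$. $\mathcal Q(\mu,\nu)$ is the set of nonnegative kernels with $\int q^x(dy)\,\mu(dx)=\nu(dy)$, and $\mathcal I_{c}(\mu,\nu)=\inf_{q\in\mathcal Q(\mu,\nu)}\int c(x,q^x)\,\mu(dx)$. *)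

theory Defs
  imports "HOL-Probability.Probability"
begin

text \<open>
  A Borel measure on a Borel subset \<open>E\<close> of Euclidean space is represented by a Borel measure on the
  whole space that is carried by \<open>E\<close>.
\<close>

definition borel_prob_on :: "'a::euclidean_space set \<Rightarrow> 'a measure set" where
  "borel_prob_on E = {M. sets M = sets borel \<and> prob_space M \<and> (AE x in M. x \<in> E)}"

definition borel_finite_on :: "'a::euclidean_space set \<Rightarrow> 'a measure set" where
  "borel_finite_on E = {M. sets M = sets borel \<and> finite_measure M \<and> (AE x in M. x \<in> E)}"

definition measure_support :: "'a::euclidean_space measure \<Rightarrow> 'a set" where
  "measure_support M = {x. \<forall>U. open U \<and> x \<in> U \<longrightarrow> emeasure M U > 0}"

definition conical_hull :: "'a::real_vector set \<Rightarrow> 'a set" where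
  "conical_hull Y = {z. \<exists>n l y. n \<ge> (1::nat) \<and> (\<forall>i<n. l i \<ge> (0::real) \<and> y i \<in> Y)
                          \<and> z = (\<Sum>i<n. l i *\<^sub>R y i)}"

lemma conical_hull_eq_convex_cone_hull:
  assumes "Y \<noteq> {}"
  shows "conical_hull Y = convex_cone hull Y"
proof
  have hull: "convex_cone (convex_cone hull Y)"
    by (rule convex_cone_convex_cone_hull)
  have "(\<Sum>i<n. l i *\<^sub>R y i) \<in> convex_cone hull Y"
    if "\<forall>i<n. l i \<ge> (0::real) \<and> y i \<in> Y" for n :: nat and l y
    using that
  proof (induction n)
    case 0
    show ?case using convex_cone_contains_0[OF hull] by simp
  next
    case (Suc n)
    then have "l n *\<^sub>R y n \<in> convex_cone hull Y"
      using convex_cone_scaleR[OF hull] by (simp add: hull_inc)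
    then show ?case using Suc convex_cone_add[OF hull] by simp
  qed
  then show "conical_hull Y \<subseteq> convex_cone hull Y"
    unfolding conical_hull_def by blast
next
  have "Y \<subseteq> conical_hull Y"
  proof
    fix y assume "y \<in> Y"
    then show "y \<in> conical_hull Y"
      unfolding conical_hull_def
      by (intro CollectI exI[of _ "1::nat"] exI[of _ "\<lambda>_. 1::real"] exI[of _ "\<lambda>_. y"]) simp
  qed
  moreover have "convex_cone (conical_hull Y)"
    unfolding convex_cone_iff
  proof (intro conjI ballI allI impI)
    obtain y where "y \<in> Y" using assms by blast
    then show "0 \<in> conical_hull Y"
      unfolding conical_hull_def
      by (intro CollectI exI[of _ "1::nat"] exI[of _ "\<lambda>_. 0::real"] exI[of _ "\<lambda>_. y"]) simp
  next
    fix u v assume "u \<in> conical_hull Y" "v \<in> conical_hull Y"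
    then obtain n k y m k' y' where
      u: "n \<ge> (1::nat)" "\<forall>i<n. k i \<ge> (0::real) \<and> y i \<in> Y" "u = (\<Sum>i<n. k i *\<^sub>R y i)" and
      v: "m \<ge> (1::nat)" "\<forall>i<m. k' i \<ge> (0::real) \<and> y' i \<in> Y" "v = (\<Sum>i<m. k' i *\<^sub>R y' i)"
      unfolding conical_hull_def by blast
    let ?l = "\<lambda>i. if i < n then k i else k' (i - n)"
    let ?y = "\<lambda>i. if i < n then y i else y' (i - n)"
    have "(\<Sum>i<n + j. ?l i *\<^sub>R ?y i) = u + (\<Sum>i<j. k' i *\<^sub>R y' i)" for j
      by (induction j) (simp_all add: u(3) add.assoc)
    then have "u + v = (\<Sum>i<n + m. ?l i *\<^sub>R ?y i)"
      unfolding v(3) by (rule sym)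
    moreover have "\<forall>i<n + m. ?l i \<ge> 0 \<and> ?y i \<in> Y"
      using u(2) v(2) by (simp add: less_diff_conv2)
    moreover have "n + m \<ge> 1" using u(1) by simp
    ultimately show "u + v \<in> conical_hull Y"
      unfolding conical_hull_def
      by (intro CollectI exI[of _ "n + m"] exI[of _ ?l] exI[of _ ?y] conjI)
  next
    fix u and c :: real assume "u \<in> conical_hull Y" "0 \<le> c"
    then obtain n k y where
      u: "n \<ge> (1::nat)" "\<forall>i<n. k i \<ge> (0::real) \<and> y i \<in> Y" "u = (\<Sum>i<n. k i *\<^sub>R y i)"
      unfolding conical_hull_def by blast
    have "c *\<^sub>R u = (\<Sum>i<n. (c * k i) *\<^sub>R y i)"
      by (simp add: u(3) scaleR_sum_right)
    moreover have "\<forall>i<n. c * k i \<ge> 0 \<and> y i \<in> Y"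
      using u(2) \<open>0 \<le> c\<close> by simp
    ultimately show "c *\<^sub>R u \<in> conical_hull Y"
      unfolding conical_hull_def using u(1)
      by (intro CollectI exI[of _ n] exI[of _ "\<lambda>i. c * k i"] exI[of _ y]) simp
  qed
  ultimately show "convex_cone hull Y \<subseteq> conical_hull Y"
    by (rule hull_minimal)
qed

definition couplings :: "'a::euclidean_space measure \<Rightarrow> 'a measure \<Rightarrow> ('a \<times> 'a) measure set" where
  "couplings \<mu> \<eta> = {\<pi>. sets \<pi> = sets borel \<and> distr \<pi> borel fst = \<mu> \<and> distr \<pi> borel snd = \<eta>}"

text \<open>The squared distance is \<open>\<infinity>\<close> if no coupling has finite cost.\<close>

definition W2_sq :: "'a::euclidean_space measure \<Rightarrow> 'a measure \<Rightarrow> ennreal" where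
  "W2_sq \<mu> \<eta> = (INF \<pi>\<in>couplings \<mu> \<eta>. \<integral>\<^sup>+ (x, z). ennreal ((norm (x - z))\<^sup>2) \<partial>\<pi>)"

definition prob_first_moment :: "'a::euclidean_space measure set" where
  "prob_first_moment = {M \<in> borel_prob_on UNIV. integrable M norm}"

definition le_phc :: "'a::euclidean_space measure \<Rightarrow> 'a measure \<Rightarrow> bool" where
  "le_phc \<eta> \<nu> \<longleftrightarrow> \<eta> \<in> prob_first_moment \<and> \<nu> \<in> prob_first_moment \<and>
     (\<forall>\<phi>::'a \<Rightarrow> real. convex_on UNIV \<phi> \<and> (\<forall>t\<ge>0. \<forall>x. \<phi> (t *\<^sub>R x) = t * \<phi> x)
        \<longrightarrow> (\<integral>x. \<phi> x \<partial>\<eta>) \<le> (\<integral>x. \<phi> x \<partial>\<nu>))"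

text \<open>Kernels are indexed by \<open>X\<close>; the value \<open>q x\<close> for \<open>x \<notin> X\<close> is irrelevant.\<close>

definition nonneg_kernels :: "'a::euclidean_space set \<Rightarrow> 'a set \<Rightarrow> ('a \<Rightarrow> 'a measure) set" where
  "nonneg_kernels X Y = {q. (\<forall>x\<in>X. q x \<in> borel_finite_on Y) \<and>
     (\<forall>A\<in>sets borel. (\<lambda>x. emeasure (q x) A) \<in> borel_measurable (restrict_space borel X))}"

definition transport_kernels ::
  "'a::euclidean_space set \<Rightarrow> 'a set \<Rightarrow> 'a measure \<Rightarrow> 'a measure \<Rightarrow> ('a \<Rightarrow> 'a measure) set" where
  "transport_kernels X Y \<mu> \<nu> = {q \<in> nonneg_kernels X Y.
     \<forall>A\<in>sets borel. (\<integral>\<^sup>+x. emeasure (q x) A \<partial>\<mu>) = emeasure \<nu> A}"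

definition kernel_cost ::
  "('a \<Rightarrow> 'a measure \<Rightarrow> ennreal) \<Rightarrow> 'a measure \<Rightarrow> ('a::euclidean_space \<Rightarrow> 'a measure) \<Rightarrow> ennreal" where
  "kernel_cost c \<mu> q = (\<integral>\<^sup>+x. c x (q x) \<partial>\<mu>)"

definition optimal_cost ::
  "('a \<Rightarrow> 'a measure \<Rightarrow> ennreal) \<Rightarrow> 'a::euclidean_space set \<Rightarrow> 'a set \<Rightarrow> 'a measure \<Rightarrow> 'a measure \<Rightarrow> ennreal"
  where "optimal_cost c X Y \<mu> \<nu> = (INF q\<in>transport_kernels X Y \<mu> \<nu>. kernel_cost c \<mu> q)"

definition minimizing_kernel ::
  "('a \<Rightarrow> 'a measure \<Rightarrow> ennreal) \<Rightarrow> 'a::euclidean_space set \<Rightarrow> 'a set \<Rightarrow> 'a measure \<Rightarrow> 'a measure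
     \<Rightarrow> ('a \<Rightarrow> 'a measure) \<Rightarrow> bool" where
  "minimizing_kernel c X Y \<mu> \<nu> q \<longleftrightarrow>
     q \<in> transport_kernels X Y \<mu> \<nu> \<and> kernel_cost c \<mu> q = optimal_cost c X Y \<mu> \<nu>"

definition c2 :: "'a::euclidean_space \<Rightarrow> 'a measure \<Rightarrow> ennreal" where
  "c2 x m = ennreal (1/2 * (norm (x - (\<integral>y. y \<partial>m)))\<^sup>2)"

end

theory Submission
  imports Defs
begin

text \<open>
Write \<open>q\<close> for a transport kernel and \<open>S\<^sub>q(x) = \<integral> y q\<^sup>x(dy)\<close> for its barycentre map. The cost of
\<open>q\<close> depends on \<open>S\<^sub>q\<close> alone, and by Jensen's inequality for sublinear (convex, positively
homogeneous) functions the law of \<open>S\<^sub>q\<close> is below \<open>\<nu>\<close> in the order \<open>le_phc\<close>. So the kernel problem is at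
least as expensive as the problem of bringing \<open>\<mu>\<close> to some \<open>\<eta> \<le>\<^sub>p\<^sub>h\<^sub>c \<nu>\<close>. The proof produces a map \<open>S\<close>
that is a limit of barycentre maps, so its cost is at least the kernel cost, together with a
certificate that no \<open>\<eta> \<le>\<^sub>p\<^sub>h\<^sub>c \<nu>\<close> can be cheaper than \<open>S\<close>. Both problems then have the same value.

The map \<open>S\<close> is the projection of the identity onto the closure, in \<open>L\<^sup>2(\<mu>)\<close>, of the convex set of
barycentre maps of kernels with a bounded density with respect to \<open>\<nu>\<close> (lemma \<open>ex_optimal_barycentre\<close>).
Its residual \<open>g(x) = x - S(x)\<close> satisfies \<open>\<integral> g \<bullet> (S\<^sub>h - S) d\<mu> \<le> 0\<close> for each such density \<open>h\<close>.

The certificate comes from testing this inequality with greedy kernels. Let \<open>c\<^sub>0, c\<^sub>1, \<dots>\<close> be the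
averages of \<open>g\<close> over sets \<open>B\<^sub>0, B\<^sub>1, \<dots>\<close> of positive measure, and let \<open>h\<close> send each \<open>y\<close> to the
normalized set \<open>B\<^sub>i\<close> for which \<open>c\<^sub>i \<bullet> y\<close> is largest among \<open>i \<le> k\<close>. Then \<open>\<integral> g \<bullet> S\<^sub>h d\<mu>\<close> is exactly
\<open>\<integral> max\<^sub>i\<^sub>\<le>\<^sub>k c\<^sub>i \<bullet> y \<nu>(dy)\<close>, so this integral is at most \<open>\<integral> g \<bullet> S d\<mu>\<close> (lemma \<open>max_inner_averages_le\<close>).
Choose countably many sets \<open>B\<^sub>i\<close> such that \<open>g\<close> lies almost everywhere in the closure of the \<open>c\<^sub>i\<close>, and
let \<open>C\<close> be the closed convex hull of the \<open>c\<^sub>i\<close>. The support function of \<open>C\<close> is the increasing limit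
of sublinear functions whose integrals against every \<open>\<eta> \<le>\<^sub>p\<^sub>h\<^sub>c \<nu>\<close> are at most \<open>\<integral> g \<bullet> S d\<mu>\<close>. This
support function is the dual potential, and the bound has two consequences.

Applied to the law of \<open>S\<close>, it forces \<open>g(x)\<close> to attain the support function of \<open>C\<close> in the direction
\<open>S(x)\<close>. This is the variational inequality that characterizes \<open>g(x)\<close> as the point of \<open>C\<close> closest to \<open>x\<close>.

Applied to the second marginal of a coupling \<open>\<pi>\<close> of \<open>\<mu>\<close> with some \<open>\<eta> \<le>\<^sub>p\<^sub>h\<^sub>c \<nu>\<close>, it gives
\<open>\<integral> |x - z|\<^sup>2 d\<pi> \<ge> \<integral> |x - S|\<^sup>2 d\<mu> + \<integral> |S(x) - z|\<^sup>2 d\<pi>\<close> (lemma \<open>coupling_cost_lower_bound\<close>). The law of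
\<open>S\<close> is therefore optimal, and the last term shows that it is the only optimal law and that every
minimizing kernel has barycentre map \<open>S\<close>.

The condition on the support of \<open>\<nu>\<close> makes the cone over its convex hull closed. The distance to this
cone is sublinear and vanishes \<open>\<nu>\<close>-almost everywhere, so every \<open>\<eta> \<le>\<^sub>p\<^sub>h\<^sub>c \<nu>\<close> is carried by the cone.
\<close>

section \<open>Sublinear functions and the positively homogeneous convex order\<close>

definition sublinear :: "('a::real_vector \<Rightarrow> real) \<Rightarrow> bool" where
  "sublinear \<phi> \<longleftrightarrow> convex_on UNIV \<phi> \<and> (\<forall>t\<ge>0. \<forall>x. \<phi> (t *\<^sub>R x) = t * \<phi> x)"

lemma sublinear_scale: "sublinear \<phi> \<Longrightarrow> 0 \<le> t \<Longrightarrow> \<phi> (t *\<^sub>R x) = t * \<phi> x"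
  by (simp add: sublinear_def)

lemma sublinear_add:
  assumes "sublinear \<phi>"
  shows "\<phi> (a + b) \<le> \<phi> a + \<phi> b"
proof -
  have "\<phi> ((1/2) *\<^sub>R a + (1/2) *\<^sub>R b) \<le> 1/2 * \<phi> a + 1/2 * \<phi> b"
    using assms convex_onD[of UNIV \<phi> "1/2" a b] unfolding sublinear_def by simp
  then have "\<phi> ((1/2) *\<^sub>R (a + b)) \<le> 1/2 * \<phi> a + 1/2 * \<phi> b"
    by (simp add: scaleR_right_distrib)
  then show ?thesis
    using sublinear_scale[OF assms, of "1/2" "a + b"] by simp
qed

lemma sublinearI:
  assumes "\<And>a b. \<phi> (a + b) \<le> \<phi> a + \<phi> b"
    and "\<And>t x. 0 \<le> t \<Longrightarrow> \<phi> (t *\<^sub>R x) = t * \<phi> x"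
  shows "sublinear \<phi>"
  unfolding sublinear_def
proof (intro conjI convex_onI)
  fix t x y assume "0 < (t::real)" "t < 1"
  then show "\<phi> ((1 - t) *\<^sub>R x + t *\<^sub>R y) \<le> (1 - t) * \<phi> x + t * \<phi> y"
    using assms(1)[of "(1 - t) *\<^sub>R x" "t *\<^sub>R y"] assms(2)[of t y] assms(2)[of "1 - t" x] by simp
qed (use assms in auto)

lemma sublinear_max:
  assumes "sublinear \<phi>" "sublinear \<psi>"
  shows "sublinear (\<lambda>x. max (\<phi> x) (\<psi> x))"
proof (rule sublinearI)
  fix a b show "max (\<phi> (a + b)) (\<psi> (a + b)) \<le> max (\<phi> a) (\<psi> a) + max (\<phi> b) (\<psi> b)"
    using sublinear_add[OF assms(1), of a b] sublinear_add[OF assms(2), of a b] by linarith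
next
  fix t :: real and x assume "0 \<le> t"
  then show "max (\<phi> (t *\<^sub>R x)) (\<psi> (t *\<^sub>R x)) = t * max (\<phi> x) (\<psi> x)"
    using assms by (simp add: sublinear_scale max_mult_distrib_left)
qed

lemma sublinear_inner: "sublinear (\<lambda>x. c \<bullet> x)"
  by (rule sublinearI) (simp_all add: inner_add_right)

text \<open>
The sum of two points of a convex cone is again in the cone, so near-optimal points for \<open>a\<close> and \<open>b\<close>
add up to a competitor for \<open>a + b\<close>. This function detects whether a measure is carried by the cone.
\<close>
lemma sublinear_infdist_cone:
  fixes D :: "'a::real_normed_vector set"
  assumes "convex D" "conic D" "D \<noteq> {}"
  shows "sublinear (\<lambda>x. infdist x D)"
proof -
  have near_point: "\<exists>u\<in>D. dist x u < infdist x D + e" if "0 < e" for x e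
    using cInf_lessD[of "dist x ` D" "infdist x D + e"] that assms(3) by (auto simp: infdist_def)
  show ?thesis
  proof (rule sublinearI)
    have addD: "u + v \<in> D" if "u \<in> D" "v \<in> D" for u v
    proof -
      have "(1/2) *\<^sub>R u + (1/2) *\<^sub>R v \<in> D"
        using assms(1) that by (intro convexD) auto
      then have "2 *\<^sub>R ((1/2) *\<^sub>R u + (1/2) *\<^sub>R v) \<in> D"
        using assms(2) by (intro conicD) auto
      then show ?thesis by (simp add: scaleR_right_distrib)
    qed
    fix a b show "infdist (a + b) D \<le> infdist a D + infdist b D"
    proof (rule field_le_epsilon)
      fix e :: real assume "0 < e"
      then obtain u v where uv: "u \<in> D" "dist a u < infdist a D + e/2" "v \<in> D" "dist b v < infdist b D + e/2"
        using near_point[of "e/2" a] near_point[of "e/2" b] by auto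
      have "infdist (a + b) D \<le> dist (a + b) (u + v)"
        using addD uv by (intro infdist_le) auto
      also have "\<dots> \<le> dist a u + dist b v"
        by (rule dist_triangle_add)
      finally show "infdist (a + b) D \<le> infdist a D + infdist b D + e"
        using uv by linarith
    qed
  next
    have le: "infdist (t *\<^sub>R x) D \<le> t * infdist x D" if t: "0 < t" for t :: real and x
    proof (rule field_le_epsilon)
      fix e :: real assume "0 < e"
      then obtain u where u: "u \<in> D" "dist x u < infdist x D + e/t"
        using near_point[of "e/t" x] t by auto
      have "infdist (t *\<^sub>R x) D \<le> dist (t *\<^sub>R x) (t *\<^sub>R u)"
        using u assms(2) that by (intro infdist_le conicD) auto
      also have "\<dots> = t * dist x u"
        using that by (simp add: dist_norm flip: scaleR_diff_right)
      also have "\<dots> \<le> t * (infdist x D + e/t)"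
        using u that by (intro mult_left_mono) auto
      finally show "infdist (t *\<^sub>R x) D \<le> t * infdist x D + e"
        using that by (simp add: distrib_left)
    qed
    fix t :: real and x assume "0 \<le> t"
    show "infdist (t *\<^sub>R x) D = t * infdist x D"
    proof (cases "t = 0")
      case True
      then show ?thesis using assms by (simp add: conic_contains_0)
    next
      case False
      then have t: "t > 0" using \<open>0 \<le> t\<close> by simp
      have "infdist ((1/t) *\<^sub>R (t *\<^sub>R x)) D \<le> (1/t) * infdist (t *\<^sub>R x) D"
        using t by (intro le) auto
      then have "t * infdist x D \<le> infdist (t *\<^sub>R x) D"
        using t by (simp add: field_simps)
      with le[OF t, of x] show ?thesis by simp
    qed
  qed
qed

lemma sublinear_continuous:
  fixes \<phi> :: "'a::euclidean_space \<Rightarrow> real"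
  assumes "sublinear \<phi>"
  shows "continuous_on UNIV \<phi>"
  using assms unfolding sublinear_def by (intro convex_on_continuous) auto

lemma sublinear_measurable:
  fixes \<phi> :: "'a::euclidean_space \<Rightarrow> real"
  shows "sublinear \<phi> \<Longrightarrow> \<phi> \<in> borel_measurable borel"
  by (intro borel_measurable_continuous_onI sublinear_continuous)

lemma sublinear_bounded:
  fixes \<phi> :: "'a::euclidean_space \<Rightarrow> real"
  assumes "sublinear \<phi>"
  obtains L where "0 \<le> L" "\<And>x. \<bar>\<phi> x\<bar> \<le> L * norm x"
proof -
  have "compact (\<phi> ` sphere 0 1)"
    using sublinear_continuous[OF assms] by (intro compact_continuous_image) (auto intro: continuous_on_subset)
  then have "bounded (\<phi> ` sphere 0 1)" by (rule compact_imp_bounded)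
  then obtain L where L: "\<And>u. u \<in> sphere 0 1 \<Longrightarrow> \<bar>\<phi> u\<bar> \<le> L"
    unfolding bounded_iff by fastforce
  have "\<bar>\<phi> x\<bar> \<le> max 0 L * norm x" for x
  proof (cases "x = 0")
    case True
    then show ?thesis using sublinear_scale[OF assms, of 0 0] by simp
  next
    case False
    then have "\<bar>\<phi> ((1 / norm x) *\<^sub>R x)\<bar> \<le> L" by (intro L) simp
    then have "\<bar>\<phi> x\<bar> / norm x \<le> L"
      by (simp add: sublinear_scale[OF assms] abs_mult)
    then have "\<bar>\<phi> x\<bar> \<le> L * norm x" using False by (simp add: field_simps)
    also have "\<dots> \<le> max 0 L * norm x" by (intro mult_right_mono) auto
    finally show ?thesis .
  qed
  then show ?thesis using that[of "max 0 L"] by auto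
qed

lemma sublinear_diff_le:
  assumes "sublinear \<phi>" "\<And>x. \<bar>\<phi> x\<bar> \<le> L * norm x"
  shows "\<phi> a \<le> \<phi> b + L * norm (a - b)"
  using sublinear_add[OF assms(1), of b "a - b"] assms(2)[of "a - b"] by simp

text \<open>
Hahn--Banach in finite dimension: the functional comes from strictly separating the closed convex
epigraph from the point \<open>(z, \<phi> z - e)\<close> just below it.
\<close>
lemma sublinear_almost_attained_by_linear:
  fixes \<phi> :: "'a::euclidean_space \<Rightarrow> real"
  assumes "sublinear \<phi>" "0 < e"
  obtains c where "\<And>x. c \<bullet> x \<le> \<phi> x" "\<phi> z - e < c \<bullet> z"
proof -
  let ?E = "{p :: 'a \<times> real. \<phi> (fst p) \<le> snd p}"
  have "convex ?E"
  proof (rule convexI)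
    fix p q :: "'a \<times> real" and u v :: real
    assume *: "p \<in> ?E" "q \<in> ?E" "0 \<le> u" "0 \<le> v" "u + v = 1"
    have "\<phi> (u *\<^sub>R fst p + v *\<^sub>R fst q) \<le> u * \<phi> (fst p) + v * \<phi> (fst q)"
      using sublinear_add[OF assms(1), of "u *\<^sub>R fst p" "v *\<^sub>R fst q"] *
      by (simp add: sublinear_scale[OF assms(1)])
    also have "\<dots> \<le> u * snd p + v * snd q"
      using * by (intro add_mono mult_left_mono) auto
    finally show "u *\<^sub>R p + v *\<^sub>R q \<in> ?E" by simp
  qed
  moreover have "closed ?E"
    by (intro closed_Collect_le continuous_intros continuous_on_compose2[OF sublinear_continuous[OF assms(1)]]) auto
  moreover have "(z, \<phi> z - e) \<notin> ?E" using assms(2) by simp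
  ultimately obtain w \<beta> where w: "w \<bullet> (z, \<phi> z - e) < \<beta>" "\<And>p. p \<in> ?E \<Longrightarrow> \<beta> < w \<bullet> p"
    using separating_hyperplane_closed_point[of ?E "(z, \<phi> z - e)"] by blast
  obtain a b where ab: "w = (a, b)" by (cases w)
  have sep: "\<beta> < a \<bullet> x + b * s" if "\<phi> x \<le> s" for x s
    using w(2)[of "(x, s)"] that by (simp add: ab inner_prod_def)
  have \<beta>: "\<beta> < 0" using sep[of 0 0] sublinear_scale[OF assms(1), of 0 0] by simp
  \<comment> \<open>the epigraph is a cone, so a functional bounded below on it is nonnegative on it\<close>
  have pos: "0 \<le> a \<bullet> x + b * s" if "\<phi> x \<le> s" for x s
  proof (rule ccontr)
    assume neg: "\<not> 0 \<le> a \<bullet> x + b * s"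
    define t where "t = \<beta> / (a \<bullet> x + b * s)"
    have t: "0 < t" using neg \<beta> by (simp add: t_def divide_neg_neg)
    have "\<beta> < a \<bullet> (t *\<^sub>R x) + b * (t * s)"
      using t that by (intro sep) (simp add: sublinear_scale[OF assms(1)])
    also have "\<dots> = t * (a \<bullet> x + b * s)" by (simp add: algebra_simps)
    also have "\<dots> = \<beta>" using neg by (simp add: t_def)
    finally show False by simp
  qed
  have z: "a \<bullet> z + b * (\<phi> z - e) < 0"
    using w(1) \<beta> by (simp add: ab inner_prod_def)
  then have "0 < b * e" using pos[of z "\<phi> z"] by (simp add: algebra_simps)
  then have b: "0 < b" using assms(2) by (simp add: zero_less_mult_iff)
  show ?thesis
  proof (rule that[of "(- 1 / b) *\<^sub>R a"])
    show "((- 1 / b) *\<^sub>R a) \<bullet> x \<le> \<phi> x" for x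
      using pos[of x "\<phi> x"] b by (simp add: field_simps)
    show "\<phi> z - e < ((- 1 / b) *\<^sub>R a) \<bullet> z"
      using z b by (simp add: field_simps)
  qed
qed

lemma sublinear_integrable:
  fixes \<phi> :: "'a::euclidean_space \<Rightarrow> real"
  assumes "sublinear \<phi>" "integrable M f"
  shows "integrable M (\<lambda>x. \<phi> (f x))"
proof -
  obtain L where L: "0 \<le> L" "\<And>x. \<bar>\<phi> x\<bar> \<le> L * norm x" using sublinear_bounded[OF assms(1)] by blast
  show ?thesis
  proof (rule Bochner_Integration.integrable_bound)
    show "integrable M (\<lambda>x. L * norm (f x))" using assms(2) by simp
    have "f \<in> borel_measurable M" using assms(2) by simp
    then show "(\<lambda>x. \<phi> (f x)) \<in> borel_measurable M"
      using sublinear_measurable[OF assms(1)] by measurable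
  qed (use L in auto)
qed

text \<open>
The measure \<open>m\<close> may have any mass: positive homogeneity replaces the normalization in Jensen's
inequality, because the minorants are linear and not only affine.
\<close>
lemma sublinear_jensen:
  fixes \<phi> :: "'a::euclidean_space \<Rightarrow> real"
  assumes "sublinear \<phi>" "integrable m f"
  shows "\<phi> (\<integral>y. f y \<partial>m) \<le> (\<integral>y. \<phi> (f y) \<partial>m)"
proof (rule field_le_epsilon)
  fix e :: real assume "0 < e"
  then obtain c where c: "\<And>x. c \<bullet> x \<le> \<phi> x" "\<phi> (\<integral>y. f y \<partial>m) - e < c \<bullet> (\<integral>y. f y \<partial>m)"
    using sublinear_almost_attained_by_linear[OF assms(1)] by metis
  have "c \<bullet> (\<integral>y. f y \<partial>m) = (\<integral>y. c \<bullet> f y \<partial>m)"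
    by (rule integral_inner_right[symmetric]) (rule assms(2))
  also have "\<dots> \<le> (\<integral>y. \<phi> (f y) \<partial>m)"
  proof (rule integral_mono)
    show "integrable m (\<lambda>y. c \<bullet> f y)" using assms(2) by (rule integrable_inner_right)
    show "integrable m (\<lambda>y. \<phi> (f y))" by (rule sublinear_integrable[OF assms])
  qed (rule c(1))
  finally show "\<phi> (\<integral>y. f y \<partial>m) \<le> (\<integral>y. \<phi> (f y) \<partial>m) + e" using c(2) by simp
qed

lemma le_phc_distrI:
  fixes T :: "'a::euclidean_space \<Rightarrow> 'a"
  assumes \<mu>: "prob_space \<mu>" and T: "integrable \<mu> T"
    and \<nu>: "sets \<nu> = sets borel" "prob_space \<nu>" "integrable \<nu> (\<lambda>y. y)"
    and le: "\<And>\<phi>. sublinear \<phi> \<Longrightarrow> (\<integral>x. \<phi> (T x) \<partial>\<mu>) \<le> (\<integral>y. \<phi> y \<partial>\<nu>)"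
  shows "le_phc (distr \<mu> borel T) \<nu>"
  unfolding le_phc_def prob_first_moment_def borel_prob_on_def
proof (intro conjI allI impI CollectI)
  have [measurable]: "T \<in> borel_measurable \<mu>" using T by simp
  show "prob_space (distr \<mu> borel T)" by (intro prob_space.prob_space_distr \<mu>) measurable
  show "integrable (distr \<mu> borel T) norm"
    using integrable_norm[OF T] by (subst integrable_distr_eq) auto
  show "integrable \<nu> norm" using \<nu>(3) by (rule integrable_norm)
  fix \<phi> :: "'a \<Rightarrow> real"
  assume "convex_on UNIV \<phi> \<and> (\<forall>t\<ge>0. \<forall>x. \<phi> (t *\<^sub>R x) = t * \<phi> x)"
  then have s: "sublinear \<phi>" by (simp add: sublinear_def)
  show "(\<integral>x. \<phi> x \<partial>distr \<mu> borel T) \<le> (\<integral>x. \<phi> x \<partial>\<nu>)"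
    using le[OF s] sublinear_measurable[OF s] by (subst integral_distr) auto
qed (auto simp: \<nu>)

lemma le_phcD: "le_phc \<eta> \<nu> \<Longrightarrow> sublinear \<phi> \<Longrightarrow> (\<integral>x. \<phi> x \<partial>\<eta>) \<le> (\<integral>x. \<phi> x \<partial>\<nu>)"
  unfolding le_phc_def sublinear_def by blast

section \<open>Maxima of finitely many linear functions\<close>

text \<open>
The maximizing index is kept as a function in its own right, since the greedy kernels
below send \<open>y\<close> to the set with this index.
\<close>
primrec argmax_inner :: "(nat \<Rightarrow> 'a::real_inner) \<Rightarrow> nat \<Rightarrow> 'a \<Rightarrow> nat" where
  "argmax_inner c 0 y = 0"
| "argmax_inner c (Suc k) y =
     (if c (argmax_inner c k y) \<bullet> y < c (Suc k) \<bullet> y then Suc k else argmax_inner c k y)"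

abbreviation max_inner :: "(nat \<Rightarrow> 'a::real_inner) \<Rightarrow> nat \<Rightarrow> 'a \<Rightarrow> real" where
  "max_inner c k y \<equiv> c (argmax_inner c k y) \<bullet> y"

lemma argmax_inner_le: "argmax_inner c k y \<le> k"
  by (induction k) auto

lemma max_inner_Suc: "max_inner c (Suc k) y = max (max_inner c k y) (c (Suc k) \<bullet> y)"
  by simp

lemma sublinear_max_inner: "sublinear (max_inner c k)"
proof (induction k)
  case 0 show ?case by (simp add: sublinear_inner)
next
  case (Suc k)
  then show ?case
    unfolding max_inner_Suc by (intro sublinear_max sublinear_inner)
qed

lemma max_inner_mono: "k \<le> l \<Longrightarrow> max_inner c k y \<le> max_inner c l y"
  by (induction l rule: dec_induct) auto

lemma inner_le_max_inner: "i \<le> k \<Longrightarrow> c i \<bullet> y \<le> max_inner c k y"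
  by (induction k) (auto simp: le_Suc_eq)

lemma measurable_argmax_inner [measurable]:
  fixes c :: "nat \<Rightarrow> 'a::euclidean_space"
  shows "argmax_inner c k \<in> measurable borel (count_space UNIV)"
proof (induction k)
  case 0 show ?case by simp
next
  case (Suc k)
  have [measurable]: "max_inner c k \<in> borel_measurable borel"
    by (rule sublinear_measurable[OF sublinear_max_inner])
  note [measurable] = Suc
  show ?case unfolding argmax_inner.simps by measurable
qed

text \<open>
Monotone convergence without an extended-valued limit. The supremum of all the maxima (a support
function) may be infinite, so only integrable functions \<open>u\<close> below it are compared; the truncations
\<open>min u (max_inner c k)\<close> are dominated and converge to \<open>u\<close>.
\<close>
lemma integral_le_of_le_SUP_max_inner:
  fixes f :: "'b \<Rightarrow> 'a::euclidean_space"
  assumes f: "integrable M f" and u: "integrable M u"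
    and bound: "\<And>k. (\<integral>x. max_inner c k (f x) \<partial>M) \<le> v"
    and approx: "AE x in M. \<forall>e>0. \<exists>k. u x - e < max_inner c k (f x)"
  shows "(\<integral>x. u x \<partial>M) \<le> v"
proof -
  note int = sublinear_integrable[OF sublinear_max_inner f]
  have "(\<lambda>k. \<integral>x. min (u x) (max_inner c k (f x)) \<partial>M) \<longlonglongrightarrow> (\<integral>x. u x \<partial>M)"
  proof (rule integral_dominated_convergence)
    show "u \<in> borel_measurable M" using u by simp
    show "(\<lambda>x. min (u x) (max_inner c k (f x))) \<in> borel_measurable M" for k
      using u int[of c k] by simp
    show "integrable M (\<lambda>x. \<bar>u x\<bar> + \<bar>max_inner c 0 (f x)\<bar>)"
      using u int[of c 0] by (intro Bochner_Integration.integrable_add integrable_abs)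
    show "AE x in M. norm (min (u x) (max_inner c k (f x))) \<le> \<bar>u x\<bar> + \<bar>max_inner c 0 (f x)\<bar>" for k
    proof (rule AE_I2)
      fix x
      show "norm (min (u x) (max_inner c k (f x))) \<le> \<bar>u x\<bar> + \<bar>max_inner c 0 (f x)\<bar>"
        using max_inner_mono[of 0 k c "f x"] by (auto simp: min_def)
    qed
    show "AE x in M. (\<lambda>k. min (u x) (max_inner c k (f x))) \<longlonglongrightarrow> u x"
      using approx
    proof eventually_elim
      case (elim x)
      show ?case
      proof (rule LIMSEQ_I)
        fix r :: real assume "0 < r"
        then obtain k where k: "u x - r < max_inner c k (f x)" using elim by blast
        have "norm (min (u x) (max_inner c n (f x)) - u x) < r" if "n \<ge> k" for n
          using max_inner_mono[OF that, of c "f x"] k \<open>0 < r\<close> by (auto simp: min_def)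
        then show "\<exists>no. \<forall>n\<ge>no. norm (min (u x) (max_inner c n (f x)) - u x) < r" by blast
      qed
    qed
  qed
  moreover have "(\<integral>x. min (u x) (max_inner c k (f x)) \<partial>M) \<le> v" for k
  proof -
    have "(\<integral>x. min (u x) (max_inner c k (f x)) \<partial>M) \<le> (\<integral>x. max_inner c k (f x) \<partial>M)"
      using u int[of c k] by (intro integral_mono integrable_min) auto
    then show ?thesis using bound[of k] by simp
  qed
  ultimately show ?thesis by (intro LIMSEQ_le_const2) auto
qed

lemma inner_le_max_inner_of_closure:
  fixes c :: "nat \<Rightarrow> 'a::real_inner"
  assumes "g \<in> closure (range c)" "e > 0"
  shows "\<exists>k. g \<bullet> z - e < max_inner c k z"
proof -
  obtain i where i: "dist (c i) g < e / (norm z + 1)"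
  proof -
    have "0 < e / (norm z + 1)" using assms(2) by (simp add: add_nonneg_pos)
    then have "\<exists>y\<in>range c. dist y g < e / (norm z + 1)"
      using assms(1) unfolding closure_approachable by blast
    then show ?thesis using that by blast
  qed
  have "\<bar>(g - c i) \<bullet> z\<bar> \<le> norm (g - c i) * norm z" by (rule Cauchy_Schwarz_ineq2)
  also have "\<dots> \<le> norm (g - c i) * (norm z + 1)" by (simp add: mult_left_mono)
  also have "\<dots> < e"
    using i by (simp add: dist_norm norm_minus_commute pos_less_divide_eq add_nonneg_pos)
  finally have "g \<bullet> z - e < c i \<bullet> z" by (simp add: inner_diff_left)
  then show ?thesis using inner_le_max_inner[of i i c z] by (intro exI[of _ i]) simp
qed

section \<open>Essential range and averages\<close>

lemma (in finite_measure) norm_average_diff_le: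
  fixes g :: "'a \<Rightarrow> 'b::euclidean_space"
  assumes g: "integrable M g" and B [measurable]: "B \<in> sets M" and pos: "measure M B > 0"
    and near: "\<And>x. x \<in> B \<Longrightarrow> norm (g x - d) \<le> r"
  shows "norm ((1 / measure M B) *\<^sub>R (\<integral>x. indicator B x *\<^sub>R g x \<partial>M) - d) \<le> r"
proof -
  have ig: "integrable M (\<lambda>x. indicator B x *\<^sub>R g x)"
    using g by (intro integrable_mult_indicator) auto
  have ii: "integrable M (\<lambda>x. indicator B x *\<^sub>R d)"
    by (intro integrable_mult_indicator) auto
  have ir: "integrable M (\<lambda>x. indicator B x *\<^sub>R r)"
    by (intro integrable_mult_indicator) auto
  have fin: "emeasure M B < \<infinity>" by (simp add: less_top[symmetric])
  have "norm (\<integral>x. indicator B x *\<^sub>R (g x - d) \<partial>M) \<le> (\<integral>x. indicator B x *\<^sub>R r \<partial>M)"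
  proof (rule order_trans[OF integral_norm_bound integral_mono])
    show "integrable M (\<lambda>x. norm (indicator B x *\<^sub>R (g x - d)))"
      unfolding scaleR_diff_right using ig ii by (intro integrable_norm Bochner_Integration.integrable_diff)
    show "norm (indicator B x *\<^sub>R (g x - d)) \<le> indicator B x *\<^sub>R r" for x
      using near[of x] by (cases "x \<in> B") auto
  qed (rule ir)
  also have "(\<integral>x. indicator B x *\<^sub>R r \<partial>M) = measure M B * r"
    using fin by (subst integral_scaleR_left) auto
  finally have "norm (\<integral>x. indicator B x *\<^sub>R (g x - d) \<partial>M) \<le> measure M B * r" .
  moreover have "(\<integral>x. indicator B x *\<^sub>R (g x - d) \<partial>M)
      = (\<integral>x. indicator B x *\<^sub>R g x \<partial>M) - measure M B *\<^sub>R d"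
    unfolding scaleR_diff_right using ig ii fin
    by (subst Bochner_Integration.integral_diff) (auto simp: integral_scaleR_left)
  moreover have "(1 / measure M B) *\<^sub>R (\<integral>x. indicator B x *\<^sub>R g x \<partial>M) - d
      = (1 / measure M B) *\<^sub>R ((\<integral>x. indicator B x *\<^sub>R g x \<partial>M) - measure M B *\<^sub>R d)"
    using pos by (simp add: scaleR_diff_right)
  ultimately show ?thesis
    using pos by (simp add: divide_le_eq mult.commute)
qed

text \<open>
Take as sets the preimages of small balls with centres in a countable dense set, and keep those of
positive measure. The discarded ones form a null set, and for every other point the average over a
preimage of a small ball around its value is close to that value.
\<close>
lemma (in finite_measure) AE_in_closure_averages:
  fixes g :: "'a \<Rightarrow> 'b::euclidean_space"
  assumes g: "integrable M g" and ne: "emeasure M (space M) \<noteq> 0"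
  obtains B :: "nat \<Rightarrow> 'a set" where "\<And>i. B i \<in> sets M" "\<And>i. measure M (B i) > 0"
    "AE x in M. g x \<in> closure (range (\<lambda>i. (1 / measure M (B i)) *\<^sub>R (\<integral>x. indicator (B i) x *\<^sub>R g x \<partial>M)))"
proof -
  have [measurable]: "g \<in> borel_measurable M" using g by simp
  define avg where "avg B = (1 / measure M B) *\<^sub>R (\<integral>x. indicator B x *\<^sub>R g x \<partial>M)" for B
  obtain D :: "'b set" where D: "countable D" "\<And>U. open U \<Longrightarrow> U \<noteq> {} \<Longrightarrow> \<exists>d\<in>D. d \<in> U"
    using countable_dense_setE by blast
  define cell where "cell p = g -` ball (fst p) (1 / Suc (snd p)) \<inter> space M" for p :: "'b \<times> nat"
  have cell_sets [measurable]: "cell p \<in> sets M" for p unfolding cell_def by measurable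
  define I where "I = {p \<in> D \<times> UNIV. measure M (cell p) > 0}"
  have cI: "countable I" using D(1) unfolding I_def by (intro countable_Collect countable_SIGMA) auto
  have "AE x in M. \<forall>p\<in>(D \<times> UNIV) - I. x \<notin> cell p"
  proof (subst AE_ball_countable)
    show "countable (D \<times> (UNIV::nat set) - I)" using D(1) by (intro countable_Diff countable_SIGMA) auto
    show "\<forall>p\<in>(D \<times> UNIV) - I. AE x in M. x \<notin> cell p"
    proof
      fix p assume "p \<in> (D \<times> UNIV) - I"
      then have "measure M (cell p) = 0" by (auto simp: I_def zero_less_measure_iff)
      then have "cell p \<in> null_sets M" by (simp add: emeasure_eq_measure null_setsI)
      then show "AE x in M. x \<notin> cell p" by (rule AE_not_in)
    qed
  qed
  then have all: "AE x in M. \<forall>p\<in>D \<times> UNIV. x \<in> cell p \<longrightarrow> p \<in> I" by eventually_elim auto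
  have dense: "\<exists>d\<in>D. g x \<in> ball d (1 / Suc n)" for x n
    using D(2)[of "ball (g x) (1 / Suc n)"] by (auto simp: dist_commute)
  have I_ne: "I \<noteq> {}"
  proof
    assume "I = {}"
    from all AE_space have "AE x in M. False"
    proof eventually_elim
      case (elim x)
      from dense[of x 0] obtain d where d: "d \<in> D" "g x \<in> ball d (1 / Suc 0)" by blast
      then have "x \<in> cell (d, 0)" using elim(2) by (simp add: cell_def)
      then show ?case using elim(1) d(1) \<open>I = {}\<close> by blast
    qed
    then show False using ne by (subst (asm) AE_iff_measurable[where N="space M"]) auto
  qed
  have near: "norm (avg (cell p) - fst p) \<le> 1 / Suc (snd p)" if "p \<in> I" for p
    unfolding avg_def using that
    by (intro norm_average_diff_le g cell_sets) (auto simp: I_def cell_def dist_norm norm_minus_commute)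
  show ?thesis
  proof (rule that[of "\<lambda>i. cell (from_nat_into I i)"])
    show "measure M (cell (from_nat_into I i)) > 0" for i
      using from_nat_into[OF I_ne, of i] by (simp add: I_def)
    show "AE x in M. g x \<in> closure (range (\<lambda>i. (1 / measure M (cell (from_nat_into I i))) *\<^sub>R
        (\<integral>x. indicator (cell (from_nat_into I i)) x *\<^sub>R g x \<partial>M)))"
      using all AE_space
    proof eventually_elim
      case (elim x)
      show ?case
        unfolding closure_approachable avg_def[symmetric]
      proof (intro allI impI)
        fix e :: real assume "0 < e"
        then obtain n :: nat where n: "1 / real (Suc n) < e / 2"
          using nat_approx_posE[of "e/2"] by auto
        obtain d where d: "d \<in> D" "g x \<in> ball d (1 / Suc n)" using dense by blast
        then have "(d, n) \<in> I" using elim by (auto simp: cell_def)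
        then obtain i where i: "from_nat_into I i = (d, n)"
          using from_nat_into_surj[OF cI] by blast
        have "dist (avg (cell (d, n))) (g x) \<le> dist (avg (cell (d, n))) d + dist d (g x)"
          by (rule dist_triangle)
        also have "\<dots> < e" using near[OF \<open>(d, n) \<in> I\<close>] d n by (simp add: dist_norm)
        finally show "\<exists>y\<in>range (\<lambda>i. avg (cell (from_nat_into I i))). dist y (g x) < e"
          using i by (metis rangeI)
      qed
    qed
  qed simp
qed

section \<open>Square-integrable maps\<close>

definition square_integrable :: "'b measure \<Rightarrow> ('b \<Rightarrow> 'a::euclidean_space) \<Rightarrow> bool" where
  "square_integrable M f \<longleftrightarrow> f \<in> borel_measurable M \<and> integrable M (\<lambda>x. (norm (f x))\<^sup>2)"

lemma square_integrable_measurable: "square_integrable M f \<Longrightarrow> f \<in> borel_measurable M"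
  by (simp add: square_integrable_def)

lemma square_integrable_norm_square: "square_integrable M f \<Longrightarrow> integrable M (\<lambda>x. (norm (f x))\<^sup>2)"
  by (simp add: square_integrable_def)

lemma square_integrable_add:
  assumes "square_integrable M f" "square_integrable M g"
  shows "square_integrable M (\<lambda>x. f x + g x)"
proof -
  note [measurable] = assms[THEN square_integrable_measurable]
  have "integrable M (\<lambda>x. (norm (f x + g x))\<^sup>2)"
  proof (rule Bochner_Integration.integrable_bound)
    show "integrable M (\<lambda>x. 2 * (norm (f x))\<^sup>2 + 2 * (norm (g x))\<^sup>2)"
      using assms by (intro Bochner_Integration.integrable_add integrable_mult_right)
        (auto simp: square_integrable_def)
    show "AE x in M. norm ((norm (f x + g x))\<^sup>2) \<le> norm (2 * (norm (f x))\<^sup>2 + 2 * (norm (g x))\<^sup>2)"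
    proof (rule AE_I2)
      fix x
      have "(norm (f x + g x))\<^sup>2 + (norm (f x - g x))\<^sup>2 = 2 * (norm (f x))\<^sup>2 + 2 * (norm (g x))\<^sup>2"
        by (simp add: power2_norm_eq_inner inner_simps inner_commute)
      then have "(norm (f x + g x))\<^sup>2 \<le> 2 * (norm (f x))\<^sup>2 + 2 * (norm (g x))\<^sup>2"
        using zero_le_power2[of "norm (f x - g x)"] by linarith
      then show "norm ((norm (f x + g x))\<^sup>2) \<le> norm (2 * (norm (f x))\<^sup>2 + 2 * (norm (g x))\<^sup>2)"
        by simp
    qed
  qed measurable
  then show ?thesis by (simp add: square_integrable_def)
qed

lemma square_integrable_scaleR:
  "square_integrable M f \<Longrightarrow> square_integrable M (\<lambda>x. c *\<^sub>R f x)"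
  by (auto simp: square_integrable_def power_mult_distrib)

lemma square_integrable_diff:
  assumes "square_integrable M f" "square_integrable M g"
  shows "square_integrable M (\<lambda>x. f x - g x)"
  using square_integrable_add[OF assms(1) square_integrable_scaleR[OF assms(2), of "-1"]] by simp

lemma integrable_inner_square_integrable:
  assumes "square_integrable M f" "square_integrable M g"
  shows "integrable M (\<lambda>x. f x \<bullet> g x)"
proof (rule Bochner_Integration.integrable_bound)
  note [measurable] = assms[THEN square_integrable_measurable]
  show "(\<lambda>x. f x \<bullet> g x) \<in> borel_measurable M" by measurable
  show "integrable M (\<lambda>x. (norm (f x))\<^sup>2 + (norm (g x))\<^sup>2)"
    using assms by (intro Bochner_Integration.integrable_add) (auto simp: square_integrable_def)
  show "AE x in M. norm (f x \<bullet> g x) \<le> norm ((norm (f x))\<^sup>2 + (norm (g x))\<^sup>2)"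
  proof (rule AE_I2)
    fix x
    have "\<bar>f x \<bullet> g x\<bar> \<le> norm (f x) * norm (g x)" by (rule Cauchy_Schwarz_ineq2)
    also have "\<dots> \<le> (norm (f x))\<^sup>2 + (norm (g x))\<^sup>2"
      using sum_squares_bound[of "norm (f x)" "norm (g x)"]
        mult_nonneg_nonneg[OF norm_ge_zero norm_ge_zero, of "f x" "g x"] by linarith
    finally show "norm (f x \<bullet> g x) \<le> norm ((norm (f x))\<^sup>2 + (norm (g x))\<^sup>2)" by simp
  qed
qed

lemma (in finite_measure) square_integrable_imp_integrable:
  fixes f :: "'a \<Rightarrow> 'b::euclidean_space"
  assumes "square_integrable M f"
  shows "integrable M f"
proof (rule Bochner_Integration.integrable_bound)
  show "integrable M (\<lambda>x. 1 + (norm (f x))\<^sup>2)"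
    using assms by (intro Bochner_Integration.integrable_add) (auto simp: square_integrable_def)
  show "AE x in M. norm (f x) \<le> norm (1 + (norm (f x))\<^sup>2)"
  proof (rule AE_I2)
    fix x
    show "norm (f x) \<le> norm (1 + (norm (f x))\<^sup>2)"
      using sum_squares_bound[of 1 "norm (f x)"] norm_ge_zero[of "f x"]
      unfolding real_norm_def by (simp only: power_one mult_1_right)
  qed
qed (use assms in \<open>simp add: square_integrable_def\<close>)

lemma (in finite_measure) bounded_imp_square_integrable:
  fixes f :: "'a \<Rightarrow> 'b::euclidean_space"
  assumes [measurable]: "f \<in> borel_measurable M" and b: "AE x in M. norm (f x) \<le> R"
  shows "square_integrable M f"
  unfolding square_integrable_def
proof (intro conjI integrable_const_bound[where B="R\<^sup>2"])
  show "AE x in M. norm ((norm (f x))\<^sup>2) \<le> R\<^sup>2"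
    using b by eventually_elim (auto intro: power_mono)
qed measurable

lemma nn_integral_norm_square:
  assumes "square_integrable M f"
  shows "(\<integral>\<^sup>+x. ennreal ((norm (f x))\<^sup>2) \<partial>M) = ennreal (\<integral>x. (norm (f x))\<^sup>2 \<partial>M)"
  using assms by (intro nn_integral_eq_integral square_integrable_norm_square) auto

lemma square_integrableI_nn_integral:
  assumes "f \<in> borel_measurable M" "(\<integral>\<^sup>+x. ennreal ((norm (f x))\<^sup>2) \<partial>M) < \<infinity>"
  shows "square_integrable M f"
  using assms by (auto simp: square_integrable_def intro!: integrableI_nonneg)

lemma integral_norm_square_add:
  assumes "square_integrable M f" "square_integrable M g"
  shows "(\<integral>x. (norm (f x + g x))\<^sup>2 \<partial>M)
    = (\<integral>x. (norm (f x))\<^sup>2 \<partial>M) + 2 * (\<integral>x. f x \<bullet> g x \<partial>M) + (\<integral>x. (norm (g x))\<^sup>2 \<partial>M)"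
proof -
  note i = integrable_inner_square_integrable[OF assms] assms[THEN square_integrable_norm_square]
  have "(\<integral>x. (norm (f x + g x))\<^sup>2 \<partial>M)
      = (\<integral>x. ((norm (f x))\<^sup>2 + 2 * (f x \<bullet> g x)) + (norm (g x))\<^sup>2 \<partial>M)"
    by (simp add: power2_norm_eq_inner inner_simps inner_commute algebra_simps)
  also have "\<dots> = (\<integral>x. (norm (f x))\<^sup>2 + 2 * (f x \<bullet> g x) \<partial>M) + (\<integral>x. (norm (g x))\<^sup>2 \<partial>M)"
    using i by (intro Bochner_Integration.integral_add Bochner_Integration.integrable_add integrable_mult_right)
  also have "(\<integral>x. (norm (f x))\<^sup>2 + 2 * (f x \<bullet> g x) \<partial>M)
      = (\<integral>x. (norm (f x))\<^sup>2 \<partial>M) + (\<integral>x. 2 * (f x \<bullet> g x) \<partial>M)"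
    using i by (intro Bochner_Integration.integral_add integrable_mult_right)
  finally show ?thesis by simp
qed

text \<open>
Continuity of the squared norm in \<open>L\<^sup>2\<close>. The cross term is controlled by the Cauchy--Schwarz
inequality for integrals, read off from the quadratic \<open>s \<mapsto> \<integral> |a + s b|\<^sup>2\<close> being nonnegative.
\<close>
lemma integral_norm_square_add_perturbation_tendsto:
  assumes a: "square_integrable M a" and b: "\<And>j. square_integrable M (b j)"
    and lim: "(\<lambda>j. \<integral>x. (norm (b j x))\<^sup>2 \<partial>M) \<longlonglongrightarrow> 0"
  shows "(\<lambda>j. \<integral>x. (norm (a x + b j x))\<^sup>2 \<partial>M) \<longlonglongrightarrow> (\<integral>x. (norm (a x))\<^sup>2 \<partial>M)"
proof -
  let ?A = "\<integral>x. (norm (a x))\<^sup>2 \<partial>M" and ?B = "\<lambda>j. \<integral>x. (norm (b j x))\<^sup>2 \<partial>M"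
  have A: "0 \<le> ?A" and B: "0 \<le> ?B j" for j by (auto intro: integral_nonneg_AE)
  have cs: "(\<integral>x. a x \<bullet> b j x \<partial>M)\<^sup>2 \<le> ?A * ?B j" for j
  proof -
    let ?I = "\<integral>x. a x \<bullet> b j x \<partial>M"
    have quad: "0 \<le> ?A + 2 * s * ?I + s\<^sup>2 * ?B j" for s
    proof -
      have "0 \<le> (\<integral>x. (norm (a x + s *\<^sub>R b j x))\<^sup>2 \<partial>M)" by (auto intro: integral_nonneg_AE)
      also have "\<dots> = ?A + 2 * (\<integral>x. a x \<bullet> (s *\<^sub>R b j x) \<partial>M) + (\<integral>x. (norm (s *\<^sub>R b j x))\<^sup>2 \<partial>M)"
        by (intro integral_norm_square_add a square_integrable_scaleR b)
      also have "\<dots> = ?A + 2 * s * ?I + s\<^sup>2 * ?B j"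
        by (simp add: power_mult_distrib)
      finally show ?thesis .
    qed
    show ?thesis
    proof (cases "?B j = 0")
      case True
      have "?I = 0"
      proof (rule ccontr)
        assume "?I \<noteq> 0"
        then show False using quad[of "- (?A + 1) / (2 * ?I)"] True A by (simp add: field_simps)
      qed
      then show ?thesis using A B[of j] by simp
    next
      case False
      then have pos: "?B j > 0" using order_le_neq_trans[OF B[of j]] by metis
      then show ?thesis using quad[of "- ?I / ?B j"] by (simp add: field_simps power2_eq_square)
    qed
  qed
  have "(\<lambda>j. sqrt (?A * ?B j)) \<longlonglongrightarrow> sqrt (?A * 0)"
    by (intro tendsto_intros lim)
  then have "(\<lambda>j. \<integral>x. a x \<bullet> b j x \<partial>M) \<longlonglongrightarrow> 0"
    unfolding mult_zero_right real_sqrt_zero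
  proof (rule Lim_null_comparison[OF always_eventually[OF allI], rotated])
    fix j
    show "norm (\<integral>x. a x \<bullet> b j x \<partial>M) \<le> sqrt (?A * ?B j)"
      using real_sqrt_le_mono[OF cs[of j]] unfolding real_sqrt_abs real_norm_def .
  qed
  then have "(\<lambda>j. ?A + 2 * (\<integral>x. a x \<bullet> b j x \<partial>M) + ?B j) \<longlonglongrightarrow> ?A + 2 * 0 + 0"
    by (intro tendsto_intros lim)
  then show ?thesis
    unfolding integral_norm_square_add[OF a b] by simp
qed

text \<open>
Completeness of \<open>L\<^sup>2\<close> in the form needed for minimizing sequences. The rate makes the increments
summable in \<open>L\<^sup>1\<close>, hence the sequence converges almost everywhere, and Fatou's lemma transfers the
\<open>L\<^sup>2\<close> bounds to the limit.
\<close>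
lemma (in prob_space) L2_limit_of_fast_Cauchy:
  fixes f :: "nat \<Rightarrow> 'a \<Rightarrow> 'b::euclidean_space"
  assumes [measurable]: "\<And>k. f k \<in> borel_measurable M"
    and Cauchy: "\<And>j k. j \<le> k \<Longrightarrow> (\<integral>\<^sup>+x. ennreal ((norm (f j x - f k x))\<^sup>2) \<partial>M) \<le> ennreal ((1/4)^j)"
  obtains F where "F \<in> borel_measurable M"
    "\<And>j. (\<integral>\<^sup>+x. ennreal ((norm (f j x - F x))\<^sup>2) \<partial>M) \<le> ennreal ((1/4)^j)"
proof -
  have L1: "(\<integral>\<^sup>+x. ennreal (norm (f (Suc j) x - f j x)) \<partial>M) \<le> ennreal ((1/2)^j)" for j
  proof -
    let ?s = "(1/2)^j :: real" and ?d = "\<lambda>x. norm (f j x - f (Suc j) x)"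
    have s: "0 < ?s" "?s * ?s = (1/4)^j" by (auto simp flip: power_mult_distrib)
    \<comment> \<open>The weight \<open>?s\<close> balances both terms of the arithmetic-geometric mean inequality.\<close>
    have am: "?d x \<le> ?s / 2 + (1 / (2 * ?s)) * (?d x)\<^sup>2" for x
    proof -
      have "2 * ?s * ?d x \<le> ?s\<^sup>2 + (?d x)\<^sup>2" by (rule sum_squares_bound)
      then show ?thesis using s by (simp add: field_simps power2_eq_square)
    qed
    have "(\<integral>\<^sup>+x. ennreal (norm (f (Suc j) x - f j x)) \<partial>M)
        \<le> (\<integral>\<^sup>+x. ennreal (?s / 2) + ennreal (1 / (2 * ?s)) * ennreal ((?d x)\<^sup>2) \<partial>M)"
    proof (rule nn_integral_mono)
      fix x
      have "ennreal (norm (f (Suc j) x - f j x)) \<le> ennreal (?s / 2 + (1 / (2 * ?s)) * (?d x)\<^sup>2)"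
        using am[of x] by (intro ennreal_leI) (simp add: norm_minus_commute)
      also have "\<dots> = ennreal (?s / 2) + ennreal ((1 / (2 * ?s)) * (?d x)\<^sup>2)"
        using s by (intro ennreal_plus) auto
      also have "ennreal ((1 / (2 * ?s)) * (?d x)\<^sup>2) = ennreal (1 / (2 * ?s)) * ennreal ((?d x)\<^sup>2)"
        using s by (intro ennreal_mult) auto
      finally show "ennreal (norm (f (Suc j) x - f j x))
          \<le> ennreal (?s / 2) + ennreal (1 / (2 * ?s)) * ennreal ((?d x)\<^sup>2)" .
    qed
    also have "\<dots> = ennreal (?s / 2) + ennreal (1 / (2 * ?s)) * (\<integral>\<^sup>+x. ennreal ((?d x)\<^sup>2) \<partial>M)"
      by (simp add: nn_integral_add nn_integral_cmult emeasure_space_1)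
    also have "\<dots> \<le> ennreal (?s / 2) + ennreal (1 / (2 * ?s)) * ennreal (?s * ?s)"
      unfolding s(2) by (intro add_left_mono mult_left_mono Cauchy) auto
    also have "\<dots> = ennreal (?s / 2 + (1 / (2 * ?s)) * (?s * ?s))"
    proof -
      have "ennreal (1 / (2 * ?s)) * ennreal (?s * ?s) = ennreal ((1 / (2 * ?s)) * (?s * ?s))"
        using s(1) by (intro ennreal_mult[symmetric]) auto
      moreover have "ennreal (?s / 2 + (1 / (2 * ?s)) * (?s * ?s)) = ennreal (?s / 2) + ennreal ((1 / (2 * ?s)) * (?s * ?s))"
        using s(1) by (intro ennreal_plus) auto
      ultimately show ?thesis by (simp only:)
    qed
    also have "?s / 2 + (1 / (2 * ?s)) * (?s * ?s) = ?s" using s(1) by (simp add: field_simps)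
    finally show ?thesis .
  qed
  have "(\<integral>\<^sup>+x. (\<Sum>j. ennreal (norm (f (Suc j) x - f j x))) \<partial>M)
      = (\<Sum>j. \<integral>\<^sup>+x. ennreal (norm (f (Suc j) x - f j x)) \<partial>M)"
    by (intro nn_integral_suminf) auto
  also have "\<dots> \<le> (\<Sum>j. ennreal ((1/2)^j))"
    by (intro suminf_le L1) auto
  also have "\<dots> = ennreal (\<Sum>j. (1/2)^j)"
    by (intro suminf_ennreal2 summable_geometric) auto
  also have "\<dots> < \<infinity>" by simp
  finally have "AE x in M. (\<Sum>j. ennreal (norm (f (Suc j) x - f j x))) \<noteq> \<infinity>"
    by (intro nn_integral_PInf_AE) auto
  then have conv: "AE x in M. convergent (\<lambda>k. f k x)"
  proof eventually_elim
    case (elim x)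
    then have "summable (\<lambda>j. norm (f (Suc j) x - f j x))"
      by (intro summable_suminf_not_top) auto
    then have "summable (\<lambda>j. f (Suc j) x - f j x)" by (rule summable_norm_cancel)
    then have "(\<lambda>n. f 0 x + (\<Sum>j<n. f (Suc j) x - f j x)) \<longlonglongrightarrow> f 0 x + (\<Sum>j. f (Suc j) x - f j x)"
      by (intro tendsto_add tendsto_const summable_LIMSEQ)
    then show ?case
      unfolding sum_lessThan_telescope[of "\<lambda>j. f j x"] by (auto simp: convergent_def)
  qed
  define F where "F x = lim (\<lambda>k. f k x)" for x
  have [measurable]: "F \<in> borel_measurable M" unfolding F_def by measurable
  have "(\<integral>\<^sup>+x. ennreal ((norm (f j x - F x))\<^sup>2) \<partial>M) \<le> ennreal ((1/4)^j)" for j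
  proof -
    have "(\<integral>\<^sup>+x. ennreal ((norm (f j x - F x))\<^sup>2) \<partial>M)
        = (\<integral>\<^sup>+x. liminf (\<lambda>k. ennreal ((norm (f j x - f k x))\<^sup>2)) \<partial>M)"
    proof (rule nn_integral_cong_AE)
      show "AE x in M. ennreal ((norm (f j x - F x))\<^sup>2) = liminf (\<lambda>k. ennreal ((norm (f j x - f k x))\<^sup>2))"
        using conv
      proof eventually_elim
        case (elim x)
        then have "(\<lambda>k. f k x) \<longlonglongrightarrow> F x" unfolding F_def by (simp add: convergent_LIMSEQ_iff)
        then have "(\<lambda>k. ennreal ((norm (f j x - f k x))\<^sup>2)) \<longlonglongrightarrow> ennreal ((norm (f j x - F x))\<^sup>2)"
          by (intro tendsto_ennrealI tendsto_intros)
        then show ?case by (intro lim_imp_Liminf[symmetric]) auto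
      qed
    qed
    also have "\<dots> \<le> liminf (\<lambda>k. \<integral>\<^sup>+x. ennreal ((norm (f j x - f k x))\<^sup>2) \<partial>M)"
      by (intro nn_integral_liminf) measurable
    also have "\<dots> \<le> ennreal ((1/4)^j)"
    proof (rule order_trans[OF Liminf_mono])
      show "\<forall>\<^sub>F k in sequentially. (\<integral>\<^sup>+x. ennreal ((norm (f j x - f k x))\<^sup>2) \<partial>M) \<le> ennreal ((1/4)^j)"
        using Cauchy by (intro eventually_sequentiallyI[of j])
    qed (simp add: Liminf_const)
    finally show ?thesis .
  qed
  then show ?thesis using that[of F] by simp
qed

section \<open>Supports and conical hulls\<close>

lemma AE_in_measure_support:
  fixes M :: "'a::euclidean_space measure"
  assumes "sets M = sets borel"
  shows "AE y in M. y \<in> measure_support M"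
proof -
  let ?N = "{U. open U \<and> emeasure M U = 0}"
  obtain N where N: "N \<subseteq> ?N" "countable N" "\<Union>N = \<Union>?N"
    using Lindelof[of ?N] by blast
  have "\<Union>N \<in> null_sets M"
    using N by (intro null_sets_UN'[where N="\<lambda>U. U", simplified]) (auto simp: null_sets_def assms)
  moreover have "{y \<in> space M. y \<notin> measure_support M} \<subseteq> \<Union>N"
    unfolding N(3) measure_support_def by (auto simp: zero_less_iff_neq_zero)
  ultimately show ?thesis by (rule AE_I')
qed

lemma closed_measure_support: "closed (measure_support M)"
proof -
  have "measure_support M = - \<Union>{U. open U \<and> emeasure M U = 0}"
    unfolding measure_support_def by (auto simp: zero_less_iff_neq_zero)
  then show ?thesis by auto
qed

lemma measure_support_subset:
  assumes "closed Y" "AE y in M. y \<in> Y" "sets M = sets borel"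
  shows "measure_support M \<subseteq> Y"
proof
  fix y assume y: "y \<in> measure_support M"
  show "y \<in> Y"
  proof (rule ccontr)
    assume "y \<notin> Y"
    moreover have "emeasure M (- Y) = 0"
      using assms sets_eq_imp_space_eq[OF assms(3)]
      by (subst (asm) AE_iff_measurable[where N="- Y"]) auto
    ultimately show False
      using y assms(1) unfolding measure_support_def by (auto simp: open_Compl)
  qed
qed

text \<open>
Let \<open>D\<close> be the cone over the convex hull of the support of \<open>\<nu>\<close>; it is closed because that hull is
compact and avoids the origin. Its distance function integrates to zero against \<open>\<nu>\<close>, hence also
against \<open>\<eta>\<close>. The cone is built from the support because the conical hull of \<open>Y\<close> need not be closed
when the convex hull of \<open>Y\<close> contains the origin.
\<close>
lemma AE_in_conical_hull_of_le_phc: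
  fixes Y :: "'a::euclidean_space set"
  assumes le: "le_phc \<eta> \<nu>" and Y: "compact Y" "AE y in \<nu>. y \<in> Y"
    and zero: "0 \<notin> convex hull (measure_support \<nu>)"
  shows "AE z in \<eta>. z \<in> conical_hull Y"
proof -
  have \<eta>: "sets \<eta> = sets borel" "integrable \<eta> norm" and \<nu>: "sets \<nu> = sets borel" "prob_space \<nu>"
    using le by (auto simp: le_phc_def prob_first_moment_def borel_prob_on_def)
  let ?K = "measure_support \<nu>"
  define D where "D = conic hull (convex hull ?K)"
  have K_Y: "?K \<subseteq> Y"
    by (rule measure_support_subset[OF compact_imp_closed[OF Y(1)] Y(2) \<nu>(1)])
  have "compact ?K"
    using compact_Int_closed[OF Y(1) closed_measure_support, of \<nu>] K_Y by (simp add: Int_absorb1)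
  then have D_closed: "closed D"
    unfolding D_def using zero by (intro closed_conic_hull_strong) (simp add: compact_convex_hull)
  have AE_K: "AE y in \<nu>. y \<in> ?K" by (rule AE_in_measure_support[OF \<nu>(1)])
  interpret nu: prob_space \<nu> by (rule \<nu>(2))
  have K_ne: "?K \<noteq> {}"
  proof
    assume "?K = {}"
    then have "AE y in \<nu>. False" using AE_K by simp
    then show False using nu.AE_const by auto
  qed
  have D: "convex D" "conic D" "D \<noteq> {}" "?K \<subseteq> D"
    unfolding D_def using K_ne
    by (auto simp: conic_hull_eq_empty intro!: convex_conic_hull convex_convex_hull conic_conic_hull hull_inc)
  have "D \<subseteq> convex_cone hull Y"
    unfolding D_def
  proof (rule hull_minimal[OF hull_minimal])
    show "?K \<subseteq> convex_cone hull Y" using K_Y hull_subset[of Y convex_cone] by blast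
  qed (auto intro: convex_convex_cone_hull conic_convex_cone_hull)
  then have D_hull: "D \<subseteq> conical_hull Y"
    using K_ne K_Y by (subst conical_hull_eq_convex_cone_hull) auto
  have s: "sublinear (\<lambda>z. infdist z D)" by (rule sublinear_infdist_cone[OF D(1-3)])
  have "integrable \<eta> (\<lambda>z. z)"
    using \<eta>(2) by (subst (asm) integrable_norm_iff) (auto simp: \<eta>(1) cong: measurable_cong_sets)
  then have int: "integrable \<eta> (\<lambda>z. infdist z D)" by (rule sublinear_integrable[OF s])
  have "(\<integral>z. infdist z D \<partial>\<eta>) \<le> (\<integral>y. infdist y D \<partial>\<nu>)"
    by (rule le_phcD[OF le s])
  also have "(\<integral>y. infdist y D \<partial>\<nu>) = 0"
  proof (rule integral_eq_zero_AE)
    show "AE y in \<nu>. infdist y D = 0" using AE_K by eventually_elim (use D(4) in auto)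
  qed
  finally have "(\<integral>z. infdist z D \<partial>\<eta>) = 0"
    by (intro antisym integral_nonneg_AE AE_I2 infdist_nonneg)
  then have "AE z in \<eta>. infdist z D = 0"
    using int by (subst (asm) integral_nonneg_eq_0_iff_AE) (auto simp: infdist_nonneg)
  then show ?thesis
    by eventually_elim (use in_closed_iff_infdist_zero[OF D_closed D(3)] D_hull in blast)
qed

text \<open>
The test functions decrease to the indicator of the closed set \<open>F\<close>. They are bounded and Lipschitz,
which is what makes them usable with estimates in mean distance.
\<close>
lemma prob_measure_eqI_infdist:
  fixes M N :: "'a::euclidean_space measure"
  assumes M: "sets M = sets borel" "prob_space M" and N: "sets N = sets borel" "prob_space N"
    and eq: "\<And>(F::'a set) n. closed F \<Longrightarrow> F \<noteq> {} \<Longrightarrow>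
      (\<integral>z. max 0 (1 - real n * infdist z F) \<partial>M) = (\<integral>z. max 0 (1 - real n * infdist z F) \<partial>N)"
  shows "M = N"
proof (rule measure_eqI_generator_eq[where \<Omega>=UNIV and E="Collect closed" and A="\<lambda>_. UNIV"])
  show "Int_stable (Collect closed :: 'a set set)" by (auto simp: Int_stable_def)
  show "sets M = sigma_sets UNIV (Collect closed)" "sets N = sigma_sets UNIV (Collect closed)"
    using M(1) N(1) by (simp_all add: borel_eq_closed)
  interpret M: prob_space M by (rule M(2))
  interpret N: prob_space N by (rule N(2))
  show "emeasure M UNIV \<noteq> \<infinity>" by simp
  fix F :: "'a set" assume "F \<in> Collect closed"
  then have F: "closed F" by simp
  show "emeasure M F = emeasure N F"
  proof (cases "F = {}")
    case False
    have lim: "(\<lambda>n. \<integral>z. max 0 (1 - real n * infdist z F) \<partial>L) \<longlonglongrightarrow> measure L F"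
      if L: "sets L = sets borel" "prob_space L" for L :: "'a measure"
    proof -
      interpret L: prob_space L by (rule L(2))
      note [measurable_cong] = L(1)
      have [measurable]: "(\<lambda>z. infdist z F) \<in> borel_measurable borel"
        by (intro borel_measurable_continuous_onI continuous_intros)
      have "(\<lambda>n. \<integral>z. max 0 (1 - real n * infdist z F) \<partial>L) \<longlonglongrightarrow> (\<integral>z. indicator F z \<partial>L)"
      proof (rule integral_dominated_convergence[where w="\<lambda>_. 1"])
        show "(\<lambda>z. indicator F z :: real) \<in> borel_measurable L"
          using F by (intro borel_measurable_indicator) (simp add: L(1))
        show "AE z in L. norm (max 0 (1 - real n * infdist z F)) \<le> 1" for n
          by (intro AE_I2) (simp add: infdist_nonneg)
        show "AE z in L. (\<lambda>n. max 0 (1 - real n * infdist z F)) \<longlonglongrightarrow> indicator F z"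
        proof (rule AE_I2)
          fix z
          show "(\<lambda>n. max 0 (1 - real n * infdist z F)) \<longlonglongrightarrow> indicator F z"
          proof (cases "z \<in> F")
            case True then show ?thesis by simp
          next
            case z: False
            then have pos: "0 < infdist z F" using F False by (simp add: infdist_pos_not_in_closed)
            obtain n0 :: nat where n0: "1 / infdist z F < real n0" using reals_Archimedean2 by blast
            have "max 0 (1 - real n * infdist z F) = 0" if "n0 \<le> n" for n
            proof -
              have "1 / infdist z F < real n" using n0 that by linarith
              then show ?thesis using pos by (simp add: field_simps)
            qed
            then show ?thesis
              using z by (intro tendsto_eventually eventually_sequentiallyI[of n0]) simp
          qed
        qed
      qed (simp_all)
      then show ?thesis using F by (simp add: L(1) sets_eq_imp_space_eq[OF L(1)])
    qed
    have "measure M F = measure N F"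
      using lim[OF M] lim[OF N] unfolding eq[OF F False] by (rule LIMSEQ_unique)
    then show ?thesis by (simp add: M.emeasure_eq_measure N.emeasure_eq_measure)
  qed simp
qed auto

section \<open>Barycentres of kernels\<close>

lemma norm_bounded_AE:
  fixes M :: "'a::real_normed_vector measure"
  assumes "compact K" "AE x in M. x \<in> K"
  obtains R where "0 \<le> R" "AE x in M. norm x \<le> R"
proof -
  obtain R where R: "\<And>y. y \<in> K \<Longrightarrow> norm y \<le> R"
    using compact_imp_bounded[OF assms(1)] unfolding bounded_iff by blast
  have "AE x in M. norm x \<le> max 0 R"
    using assms(2) by eventually_elim (use R in \<open>auto simp: le_max_iff_disj\<close>)
  then show ?thesis using that[of "max 0 R"] by simp
qed

text \<open>
A kernel that is defined on the whole space and not only on a subset, so that its integrals are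
measurable functions on the whole space. The masses of the \<open>\<kappa> x\<close> are finite but need not be bounded
in \<open>x\<close>.
\<close>
locale borel_kernel =
  fixes \<kappa> :: "'a::euclidean_space \<Rightarrow> 'a measure" and \<mu> \<nu> :: "'a measure" and Y
  assumes sets_kernel [measurable_cong]: "\<And>x. sets (\<kappa> x) = sets borel"
    and finite_kernel: "\<And>x. finite_measure (\<kappa> x)"
    and kernel_carrier: "\<And>x. AE y in \<kappa> x. y \<in> Y"
    and measurable_kernel: "\<And>A. A \<in> sets borel \<Longrightarrow> (\<lambda>x. emeasure (\<kappa> x) A) \<in> borel_measurable borel"
    and kernel_marginal: "\<And>A. A \<in> sets borel \<Longrightarrow> (\<integral>\<^sup>+x. emeasure (\<kappa> x) A \<partial>\<mu>) = emeasure \<nu> A"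
    and sets_first [measurable_cong]: "sets \<mu> = sets borel" and prob_first: "prob_space \<mu>"
    and sets_second [measurable_cong]: "sets \<nu> = sets borel" and prob_second: "prob_space \<nu>"
    and compact_carrier: "compact Y"
begin

lemma kernel_nn_integral:
  assumes "f \<in> borel_measurable borel"
  shows "(\<lambda>x. \<integral>\<^sup>+y. f y \<partial>\<kappa> x) \<in> borel_measurable borel \<and> (\<integral>\<^sup>+x. (\<integral>\<^sup>+y. f y \<partial>\<kappa> x) \<partial>\<mu>) = (\<integral>\<^sup>+y. f y \<partial>\<nu>)"
  using assms
proof (induction rule: borel_measurable_induct)
  case (cong f g)
  then show ?case by (simp cong: nn_integral_cong)
next
  case (set A)
  then show ?case by (simp add: measurable_kernel kernel_marginal)
next
  case (mult u c)
  note [measurable] = mult(2) conjunct1[OF mult(4)]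
  show ?case using mult(4) by (simp add: nn_integral_cmult)
next
  case (add u v)
  note [measurable] = add.hyps(1,3) add.IH[THEN conjunct1]
  show ?case using add.IH by (simp add: nn_integral_add)
next
  case (seq U)
  note [measurable] = seq(1)
  have mono: "mono (\<lambda>i x. \<integral>\<^sup>+y. U i y \<partial>\<kappa> x)"
    using seq(3) by (auto simp: mono_def le_fun_def intro!: nn_integral_mono)
  have sup: "(\<integral>\<^sup>+y. (SUP i. U i) y \<partial>M) = (SUP i. \<integral>\<^sup>+y. U i y \<partial>M)" if "sets M = sets borel" for M
    unfolding SUP_apply using that
    by (intro nn_integral_monotone_convergence_SUP seq(3)) (simp cong: measurable_cong_sets)
  have [measurable]: "(\<lambda>x. \<integral>\<^sup>+y. U i y \<partial>\<kappa> x) \<in> borel_measurable borel" for i using seq by blast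
  have "(\<integral>\<^sup>+x. (SUP i. \<integral>\<^sup>+y. U i y \<partial>\<kappa> x) \<partial>\<mu>) = (SUP i. \<integral>\<^sup>+x. (\<integral>\<^sup>+y. U i y \<partial>\<kappa> x) \<partial>\<mu>)"
    by (intro nn_integral_monotone_convergence_SUP mono) measurable
  then have "(\<integral>\<^sup>+x. (\<integral>\<^sup>+y. (SUP i. U i) y \<partial>\<kappa> x) \<partial>\<mu>) = (\<integral>\<^sup>+y. (SUP i. U i) y \<partial>\<nu>)"
    unfolding sup[OF sets_kernel] sup[OF sets_second] using seq.IH by simp
  moreover have "(\<lambda>x. \<integral>\<^sup>+y. (SUP i. U i) y \<partial>\<kappa> x) \<in> borel_measurable borel"
    unfolding sup[OF sets_kernel] by measurable
  ultimately show ?case by blast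
qed

text \<open>
For signed \<open>f\<close> the disintegration formula follows from the positive and the negative part of \<open>f\<close>
separately; the integrability hypotheses make all integrals of these parts finite.
\<close>
lemma kernel_integral:
  fixes f :: "'a \<Rightarrow> real"
  assumes f [measurable]: "f \<in> borel_measurable borel"
    and int: "integrable \<nu> f" and intk: "\<And>x. integrable (\<kappa> x) f"
  shows "(\<lambda>x. \<integral>y. f y \<partial>\<kappa> x) \<in> borel_measurable borel"
    and "integrable \<mu> (\<lambda>x. \<integral>y. f y \<partial>\<kappa> x)"
    and "(\<integral>x. (\<integral>y. f y \<partial>\<kappa> x) \<partial>\<mu>) = (\<integral>y. f y \<partial>\<nu>)"
proof -
  have part: "(\<lambda>x. enn2real (\<integral>\<^sup>+y. ennreal (u y) \<partial>\<kappa> x)) \<in> borel_measurable borel \<and>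
      integrable \<mu> (\<lambda>x. enn2real (\<integral>\<^sup>+y. ennreal (u y) \<partial>\<kappa> x)) \<and>
      (\<integral>x. enn2real (\<integral>\<^sup>+y. ennreal (u y) \<partial>\<kappa> x) \<partial>\<mu>) = enn2real (\<integral>\<^sup>+y. ennreal (u y) \<partial>\<nu>)"
    if [measurable]: "u \<in> borel_measurable borel" and i: "integrable \<nu> u" "\<And>x. integrable (\<kappa> x) u" for u :: "'a \<Rightarrow> real"
  proof -
    have K: "(\<lambda>x. \<integral>\<^sup>+y. ennreal (u y) \<partial>\<kappa> x) \<in> borel_measurable borel"
        "(\<integral>\<^sup>+x. (\<integral>\<^sup>+y. ennreal (u y) \<partial>\<kappa> x) \<partial>\<mu>) = (\<integral>\<^sup>+y. ennreal (u y) \<partial>\<nu>)"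
      using kernel_nn_integral[of "\<lambda>y. ennreal (u y)"] by auto
    note [measurable] = K(1)
    have fin: "(\<integral>\<^sup>+y. ennreal (u y) \<partial>\<kappa> x) < top" for x
      using i(2)[of x] by (simp add: real_integrable_def less_top)
    have fin2: "(\<integral>\<^sup>+y. ennreal (u y) \<partial>\<nu>) < top"
      using i(1) by (simp add: real_integrable_def less_top)
    have eq: "(\<integral>\<^sup>+x. ennreal (enn2real (\<integral>\<^sup>+y. ennreal (u y) \<partial>\<kappa> x)) \<partial>\<mu>) = (\<integral>\<^sup>+y. ennreal (u y) \<partial>\<nu>)"
      using K(2) fin by simp
    have "integrable \<mu> (\<lambda>x. enn2real (\<integral>\<^sup>+y. ennreal (u y) \<partial>\<kappa> x))"
      using eq fin2 by (intro integrableI_nonneg) auto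
    moreover have "(\<integral>x. enn2real (\<integral>\<^sup>+y. ennreal (u y) \<partial>\<kappa> x) \<partial>\<mu>) = enn2real (\<integral>\<^sup>+y. ennreal (u y) \<partial>\<nu>)"
      using eq by (subst integral_eq_nn_integral) auto
    ultimately show ?thesis by simp
  qed
  note P = part[OF f int intk]
  have "(\<lambda>y. - f y) \<in> borel_measurable borel" "integrable \<nu> (\<lambda>y. - f y)" "\<And>x. integrable (\<kappa> x) (\<lambda>y. - f y)"
    using int intk by auto
  note N = part[OF this]
  have eq: "(\<integral>y. f y \<partial>\<kappa> x) = enn2real (\<integral>\<^sup>+y. ennreal (f y) \<partial>\<kappa> x) - enn2real (\<integral>\<^sup>+y. ennreal (- f y) \<partial>\<kappa> x)" for x
    by (rule real_lebesgue_integral_def[OF intk])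
  show "(\<lambda>x. \<integral>y. f y \<partial>\<kappa> x) \<in> borel_measurable borel"
    unfolding eq using P N by auto
  show "integrable \<mu> (\<lambda>x. \<integral>y. f y \<partial>\<kappa> x)"
    unfolding eq using P N by (intro Bochner_Integration.integrable_diff) auto
  show "(\<integral>x. (\<integral>y. f y \<partial>\<kappa> x) \<partial>\<mu>) = (\<integral>y. f y \<partial>\<nu>)"
    unfolding eq real_lebesgue_integral_def[OF int] using P N
    by (subst Bochner_Integration.integral_diff) auto
qed

lemma second_carrier: "AE y in \<nu>. y \<in> Y"
proof -
  have Y: "- Y \<in> sets borel" using compact_carrier by (auto simp: compact_imp_closed)
  have "emeasure (\<kappa> x) (- Y) = 0" for x
    using kernel_carrier[of x] Y
    by (subst (asm) AE_iff_measurable[where N="- Y"]) (auto simp: sets_kernel sets_eq_imp_space_eq[OF sets_kernel])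
  then have "emeasure \<nu> (- Y) = 0" using kernel_marginal[OF Y] by simp
  then show ?thesis
    using Y by (subst AE_iff_measurable[where N="- Y"]) (auto simp: sets_second sets_eq_imp_space_eq[OF sets_second])
qed

lemma integrable_kernel_id: "integrable (\<kappa> x) (\<lambda>y. y)"
proof -
  obtain R where "AE y in \<kappa> x. norm y \<le> R" using norm_bounded_AE[OF compact_carrier kernel_carrier] by blast
  then show ?thesis
    by (intro finite_measure.integrable_const_bound[OF finite_kernel, where B=R]) auto
qed

lemma integrable_second_id: "integrable \<nu> (\<lambda>y. y)"
proof -
  obtain R where "AE y in \<nu>. norm y \<le> R" using norm_bounded_AE[OF compact_carrier second_carrier] by blast
  then show ?thesis
    by (intro finite_measure.integrable_const_bound[OF prob_space.finite_measure[OF prob_second], where B=R]) auto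
qed

lemma measurable_kernel_barycentre [measurable]: "(\<lambda>x. \<integral>y. y \<partial>\<kappa> x) \<in> borel_measurable borel"
proof (subst borel_measurable_euclidean_space, rule ballI)
  fix b :: 'a
  have "(\<lambda>x. \<integral>y. y \<bullet> b \<partial>\<kappa> x) \<in> borel_measurable borel"
    by (intro kernel_integral(1) integrable_inner_left integrable_kernel_id integrable_second_id) measurable
  then show "(\<lambda>x. (\<integral>y. y \<partial>\<kappa> x) \<bullet> b) \<in> borel_measurable borel"
    by (simp add: integrable_kernel_id)
qed

lemma sublinear_kernel_barycentre:
  fixes \<phi> :: "'a \<Rightarrow> real"
  assumes "sublinear \<phi>" and int: "integrable \<mu> (\<lambda>x. \<integral>y. y \<partial>\<kappa> x)"
  shows "(\<integral>x. \<phi> (\<integral>y. y \<partial>\<kappa> x) \<partial>\<mu>) \<le> (\<integral>y. \<phi> y \<partial>\<nu>)"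
proof -
  note K = kernel_integral[OF sublinear_measurable[OF assms(1)]
      sublinear_integrable[OF assms(1) integrable_second_id]
      sublinear_integrable[OF assms(1) integrable_kernel_id]]
  have "(\<integral>x. \<phi> (\<integral>y. y \<partial>\<kappa> x) \<partial>\<mu>) \<le> (\<integral>x. (\<integral>y. \<phi> y \<partial>\<kappa> x) \<partial>\<mu>)"
    by (intro integral_mono sublinear_integrable[OF assms] K(2) sublinear_jensen[OF assms(1)] integrable_kernel_id)
  then show ?thesis using K(3) by simp
qed

lemma integrable_kernel_barycentre: "integrable \<mu> (\<lambda>x. \<integral>y. y \<partial>\<kappa> x)"
proof (rule Bochner_Integration.integrable_bound)
  show "integrable \<mu> (\<lambda>x. \<integral>y. norm y \<partial>\<kappa> x)"
    by (intro kernel_integral(2) integrable_norm integrable_second_id integrable_kernel_id) measurable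
  show "AE x in \<mu>. norm (\<integral>y. y \<partial>\<kappa> x) \<le> norm (\<integral>y. norm y \<partial>\<kappa> x)"
    by (intro AE_I2 order_trans[OF integral_norm_bound]) simp
qed measurable

lemma le_phc_distr_kernel_barycentre: "le_phc (distr \<mu> borel (\<lambda>x. \<integral>y. y \<partial>\<kappa> x)) \<nu>"
  by (intro le_phc_distrI prob_first prob_second sets_second integrable_second_id
      integrable_kernel_barycentre sublinear_kernel_barycentre)

end

section \<open>Couplings, kernels and kernels with bounded densities\<close>

locale compact_marginals =
  fixes X Y :: "'a::euclidean_space set" and \<mu> \<nu> :: "'a measure"
  assumes compact_X: "compact X" and compact_Y: "compact Y"
    and mu_on: "\<mu> \<in> borel_prob_on X" and nu_on: "\<nu> \<in> borel_prob_on Y"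
begin

lemma sets_mu [measurable_cong]: "sets \<mu> = sets borel" and sets_nu [measurable_cong]: "sets \<nu> = sets borel"
  and AE_mu: "AE x in \<mu>. x \<in> X" and AE_nu: "AE y in \<nu>. y \<in> Y"
  using mu_on nu_on by (auto simp: borel_prob_on_def)

sublocale mu: prob_space \<mu> using mu_on by (simp add: borel_prob_on_def)
sublocale nu: prob_space \<nu> using nu_on by (simp add: borel_prob_on_def)
sublocale product: pair_prob_space \<mu> \<nu> ..

lemma square_integrable_id: "square_integrable \<mu> (\<lambda>x. x)"
proof -
  obtain R where "AE x in \<mu>. norm x \<le> R" using norm_bounded_AE[OF compact_X AE_mu] by blast
  then show ?thesis by (intro mu.bounded_imp_square_integrable) auto
qed

lemma coupling_marginals:
  assumes "\<pi> \<in> couplings \<mu> \<eta>"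
  shows "sets \<pi> = sets (borel :: ('a \<times> 'a) measure)" "fst \<in> measurable \<pi> \<mu>" "snd \<in> measurable \<pi> borel"
    "distr \<pi> \<mu> fst = \<mu>" "distr \<pi> borel snd = \<eta>" "prob_space \<pi>"
proof -
  have \<pi>: "sets \<pi> = sets borel" "distr \<pi> borel fst = \<mu>" "distr \<pi> borel snd = \<eta>"
    using assms by (auto simp: couplings_def)
  show "sets \<pi> = sets borel" "distr \<pi> borel snd = \<eta>" by fact+
  have m: "fst \<in> measurable \<pi> borel" "snd \<in> measurable \<pi> borel"
    unfolding measurable_cong_sets[OF \<pi>(1) refl] borel_prod[symmetric] by measurable
  show "snd \<in> measurable \<pi> borel" by fact
  show "fst \<in> measurable \<pi> \<mu>" using m(1) unfolding measurable_cong_sets[OF refl sets_mu] .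
  show "distr \<pi> \<mu> fst = \<mu>" using \<pi>(2) distr_cong[OF refl sets_mu, of \<pi> fst fst] by simp
  show "prob_space \<pi>"
    using mu.prob_space_axioms prob_space_distrD[OF m(1)] unfolding \<pi>(2) by blast
qed

lemma square_integrable_fst:
  assumes "\<pi> \<in> couplings \<mu> \<eta>" "square_integrable \<mu> f"
  shows "square_integrable \<pi> (\<lambda>p. f (fst p))"
    "(\<integral>p. (norm (f (fst p)))\<^sup>2 \<partial>\<pi>) = (\<integral>x. (norm (f x))\<^sup>2 \<partial>\<mu>)"
proof -
  note \<pi> = coupling_marginals[OF assms(1)]
  have f: "f \<in> borel_measurable \<mu>" by (rule square_integrable_measurable[OF assms(2)])
  then have f2: "(\<lambda>x. (norm (f x))\<^sup>2) \<in> borel_measurable \<mu>" by measurable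
  show "square_integrable \<pi> (\<lambda>p. f (fst p))"
    using integrable_distr_eq[OF \<pi>(2) f2] assms(2) measurable_compose[OF \<pi>(2) f]
    unfolding \<pi>(4) by (simp add: square_integrable_def)
  show "(\<integral>p. (norm (f (fst p)))\<^sup>2 \<partial>\<pi>) = (\<integral>x. (norm (f x))\<^sup>2 \<partial>\<mu>)"
    using integral_distr[OF \<pi>(2) f2] unfolding \<pi>(4) by simp
qed

lemma graph_coupling:
  assumes [measurable]: "T \<in> borel_measurable borel"
  shows "distr \<mu> borel (\<lambda>x. (x, T x)) \<in> couplings \<mu> (distr \<mu> borel T)"
    and "f \<in> borel_measurable borel \<Longrightarrow>
      (\<integral>\<^sup>+p. f p \<partial>distr \<mu> borel (\<lambda>x. (x, T x))) = (\<integral>\<^sup>+x. f (x, T x) \<partial>\<mu>)"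
proof -
  have m: "(\<lambda>x. (x, T x)) \<in> measurable \<mu> borel"
    unfolding borel_prod[symmetric] by measurable
  have fs: "fst \<in> measurable (borel :: ('a \<times> 'a) measure) borel" "snd \<in> measurable (borel :: ('a \<times> 'a) measure) borel"
    unfolding borel_prod[symmetric] by measurable
  have "distr (distr \<mu> borel (\<lambda>x. (x, T x))) borel fst = \<mu>"
    by (subst distr_distr[OF fs(1) m]) (simp add: o_def distr_id2 sets_mu)
  moreover have "distr (distr \<mu> borel (\<lambda>x. (x, T x))) borel snd = distr \<mu> borel T"
    by (subst distr_distr[OF fs(2) m]) (simp add: o_def)
  ultimately show "distr \<mu> borel (\<lambda>x. (x, T x)) \<in> couplings \<mu> (distr \<mu> borel T)"
    by (simp add: couplings_def)
  show "(\<integral>\<^sup>+p. f p \<partial>distr \<mu> borel (\<lambda>x. (x, T x))) = (\<integral>\<^sup>+x. f (x, T x) \<partial>\<mu>)"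
    if "f \<in> borel_measurable borel"
    using nn_integral_distr[OF m] that by simp
qed

lemma borel_measurable_dist_square: "(\<lambda>p. ennreal ((norm (fst p - snd p))\<^sup>2)) \<in> borel_measurable (borel :: ('a \<times> 'a) measure)"
  unfolding borel_prod[symmetric] by measurable

text \<open>
Densities with respect to \<open>\<nu>\<close> of a particularly tame class of transport kernels. They form a convex
set, all integrals over them are finite, and they suffice to approximate the optimal cost. The
marginal condition is imposed at every \<open>y\<close>, which the constant and the greedy kernels satisfy and
which saves null sets that depend on the kernel.
\<close>
definition densities :: "('a \<Rightarrow> 'a \<Rightarrow> real) set" where
  "densities = {h. case_prod h \<in> borel_measurable (borel \<Otimes>\<^sub>M borel) \<and>
     (\<exists>B. \<forall>x y. 0 \<le> h x y \<and> h x y \<le> B) \<and> (\<forall>y. (\<integral>x. h x y \<partial>\<mu>) = 1)}"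

definition barycentre :: "('a \<Rightarrow> 'a \<Rightarrow> real) \<Rightarrow> 'a \<Rightarrow> 'a" where
  "barycentre h x = (\<integral>y. h x y *\<^sub>R y \<partial>\<nu>)"

lemma densities_measurable:
  "h \<in> densities \<Longrightarrow> case_prod h \<in> borel_measurable (borel \<Otimes>\<^sub>M borel)"
  by (simp add: densities_def)

lemma densities_nonneg: "h \<in> densities \<Longrightarrow> 0 \<le> h x y"
  by (auto simp: densities_def)

lemma densities_integral: "h \<in> densities \<Longrightarrow> (\<integral>x. h x y \<partial>\<mu>) = 1"
  by (simp add: densities_def)

lemma densities_bounded:
  assumes "h \<in> densities"
  obtains B where "0 \<le> B" "\<And>x y. h x y \<le> B"
proof -
  obtain B where B: "\<forall>x y. 0 \<le> h x y \<and> h x y \<le> B" using assms unfolding densities_def by blast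
  then have "0 \<le> h 0 0" "h 0 0 \<le> B" by blast+
  then have "0 \<le> B" by linarith
  then show ?thesis using that B by blast
qed

lemma one_in_densities: "(\<lambda>x y. 1) \<in> densities"
  by (auto simp: densities_def mu.prob_space)

lemma integrable_density_barycentre:
  assumes "h \<in> densities"
  shows "integrable \<nu> (\<lambda>y. h x y *\<^sub>R y)"
proof -
  note [measurable] = densities_measurable[OF assms]
  obtain B where B: "0 \<le> B" "\<And>x y. h x y \<le> B" using densities_bounded[OF assms] by blast
  obtain R where R: "0 \<le> R" "AE y in \<nu>. norm y \<le> R" using norm_bounded_AE[OF compact_Y AE_nu] by blast
  show ?thesis
  proof (rule nu.integrable_const_bound[where B="B * R"])
    show "AE y in \<nu>. norm (h x y *\<^sub>R y) \<le> B * R"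
      using R(2) by eventually_elim (use B densities_nonneg[OF assms] in \<open>auto intro!: mult_mono\<close>)
  qed measurable
qed

lemma integrable_density_fst:
  assumes "h \<in> densities"
  shows "integrable \<mu> (\<lambda>x. h x y)"
proof -
  note [measurable] = densities_measurable[OF assms]
  obtain B where B: "0 \<le> B" "\<And>x y. h x y \<le> B" using densities_bounded[OF assms] by blast
  show ?thesis
    by (rule mu.integrable_const_bound[where B=B]) (use B densities_nonneg[OF assms] in auto)
qed

lemma measurable_barycentre:
  assumes "h \<in> densities"
  shows "barycentre h \<in> borel_measurable borel"
proof -
  note [measurable] = densities_measurable[OF assms]
  show ?thesis unfolding barycentre_def by measurable
qed

lemma square_integrable_barycentre:
  assumes "h \<in> densities"
  shows "square_integrable \<mu> (barycentre h)"
proof -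
  note [measurable] = densities_measurable[OF assms] measurable_barycentre[OF assms]
  obtain B where B: "0 \<le> B" "\<And>x y. h x y \<le> B" using densities_bounded[OF assms] by blast
  obtain R where R: "0 \<le> R" "AE y in \<nu>. norm y \<le> R" using norm_bounded_AE[OF compact_Y AE_nu] by blast
  have "norm (barycentre h x) \<le> B * R" for x
  proof -
    have "norm (barycentre h x) \<le> (\<integral>y. norm (h x y *\<^sub>R y) \<partial>\<nu>)"
      unfolding barycentre_def by (rule integral_norm_bound)
    also have "\<dots> \<le> (\<integral>y. B * R \<partial>\<nu>)"
    proof (rule integral_mono_AE)
      show "AE y in \<nu>. norm (h x y *\<^sub>R y) \<le> B * R"
        using R(2) by eventually_elim (use B densities_nonneg[OF assms] in \<open>auto intro!: mult_mono\<close>)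
    qed (simp_all only: integrable_norm[OF integrable_density_barycentre[OF assms]] nu.integrable_const)
    finally show ?thesis by (simp add: nu.prob_space)
  qed
  then show ?thesis by (intro mu.bounded_imp_square_integrable[where R="B * R"]) auto
qed

lemma densities_convex:
  assumes h: "h \<in> densities" "h' \<in> densities" and t: "0 \<le> t" "t \<le> 1"
  shows "(\<lambda>x y. (1 - t) * h x y + t * h' x y) \<in> densities"
    and "barycentre (\<lambda>x y. (1 - t) * h x y + t * h' x y) x = (1 - t) *\<^sub>R barycentre h x + t *\<^sub>R barycentre h' x"
proof -
  note [measurable] = h[THEN densities_measurable]
  obtain B where B: "0 \<le> B" "\<And>x y. h x y \<le> B" using densities_bounded[OF h(1)] by blast
  obtain B' where B': "0 \<le> B'" "\<And>x y. h' x y \<le> B'" using densities_bounded[OF h(2)] by blast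
  have "(1 - t) * h x y + t * h' x y \<le> (1 - t) * B + t * B'" for x y
    using t B B' by (intro add_mono mult_left_mono) auto
  moreover have "0 \<le> (1 - t) * h x y + t * h' x y" for x y
    using t densities_nonneg h by auto
  moreover have "(\<integral>x. (1 - t) * h x y + t * h' x y \<partial>\<mu>) = 1" for y
    using h by (simp add: integrable_density_fst densities_integral)
  ultimately show "(\<lambda>x y. (1 - t) * h x y + t * h' x y) \<in> densities"
    unfolding densities_def by (intro CollectI conjI) auto
  have "(\<integral>y. ((1 - t) * h x y + t * h' x y) *\<^sub>R y \<partial>\<nu>)
      = (\<integral>y. (1 - t) *\<^sub>R (h x y *\<^sub>R y) + t *\<^sub>R (h' x y *\<^sub>R y) \<partial>\<nu>)"
    by (simp add: scaleR_left_distrib)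
  also have "\<dots> = (1 - t) *\<^sub>R barycentre h x + t *\<^sub>R barycentre h' x"
    unfolding barycentre_def using h
    by (subst Bochner_Integration.integral_add)
      (auto simp: integrable_density_barycentre simp del: scaleR_scaleR)
  finally show "barycentre (\<lambda>x y. (1 - t) * h x y + t * h' x y) x = (1 - t) *\<^sub>R barycentre h x + t *\<^sub>R barycentre h' x"
    unfolding barycentre_def .
qed

lemma density_transport_kernel:
  assumes h: "h \<in> densities"
  shows "(\<lambda>x. density \<nu> (\<lambda>y. ennreal (h x y))) \<in> transport_kernels X Y \<mu> \<nu>"
    and "(\<integral>y. y \<partial>density \<nu> (\<lambda>y. ennreal (h x y))) = barycentre h x"
proof -
  note [measurable] = densities_measurable[OF h]
  obtain B where B: "0 \<le> B" "\<And>x y. h x y \<le> B" using densities_bounded[OF h] by blast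
  have em: "emeasure (density \<nu> (\<lambda>y. ennreal (h x y))) A = (\<integral>\<^sup>+y. ennreal (h x y) * indicator A y \<partial>\<nu>)"
    if "A \<in> sets borel" for x A
    using that by (intro emeasure_density) (auto simp: sets_nu)
  have fin: "finite_measure (density \<nu> (\<lambda>y. ennreal (h x y)))" for x
  proof (rule finite_measureI)
    have "emeasure (density \<nu> (\<lambda>y. ennreal (h x y))) UNIV \<le> (\<integral>\<^sup>+y. ennreal B \<partial>\<nu>)"
      unfolding em[OF sets.top[of borel, unfolded space_borel]] using B by (intro nn_integral_mono) (simp add: ennreal_leI)
    also have "\<dots> < \<infinity>" by (simp add: nu.emeasure_space_1)
    finally show "emeasure (density \<nu> (\<lambda>y. ennreal (h x y))) (space (density \<nu> (\<lambda>y. ennreal (h x y)))) \<noteq> \<infinity>"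
      by (simp add: sets_eq_imp_space_eq[OF sets_nu])
  qed
  have on_Y: "density \<nu> (\<lambda>y. ennreal (h x y)) \<in> borel_finite_on Y" for x
    unfolding borel_finite_on_def using fin[of x] AE_nu by (auto simp: sets_nu AE_density)
  have meas: "(\<lambda>x. emeasure (density \<nu> (\<lambda>y. ennreal (h x y))) A) \<in> borel_measurable borel"
    if [measurable]: "A \<in> sets borel" for A
    unfolding em[OF that] by measurable
  have marg: "(\<integral>\<^sup>+x. emeasure (density \<nu> (\<lambda>y. ennreal (h x y))) A \<partial>\<mu>) = emeasure \<nu> A"
    if A [measurable]: "A \<in> sets borel" for A
  proof -
    have "(\<integral>\<^sup>+x. emeasure (density \<nu> (\<lambda>y. ennreal (h x y))) A \<partial>\<mu>)
        = (\<integral>\<^sup>+y. (\<integral>\<^sup>+x. ennreal (h x y) * indicator A y \<partial>\<mu>) \<partial>\<nu>)"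
      unfolding em[OF A] by (intro product.Fubini'[symmetric]) measurable
    also have "\<dots> = (\<integral>\<^sup>+y. indicator A y \<partial>\<nu>)"
    proof (rule nn_integral_cong)
      fix y
      have "(\<integral>\<^sup>+x. ennreal (h x y) \<partial>\<mu>) = ennreal (\<integral>x. h x y \<partial>\<mu>)"
        by (intro nn_integral_eq_integral integrable_density_fst h AE_I2 densities_nonneg)
      then show "(\<integral>\<^sup>+x. ennreal (h x y) * indicator A y \<partial>\<mu>) = indicator A y"
        by (subst nn_integral_multc) (auto simp: densities_integral[OF h])
    qed
    finally show ?thesis by (simp add: sets_nu)
  qed
  show "(\<lambda>x. density \<nu> (\<lambda>y. ennreal (h x y))) \<in> transport_kernels X Y \<mu> \<nu>"
    unfolding transport_kernels_def nonneg_kernels_def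
    using on_Y marg meas by (auto intro: measurable_restrict_space1)
  show "(\<integral>y. y \<partial>density \<nu> (\<lambda>y. ennreal (h x y))) = barycentre h x"
    unfolding barycentre_def by (intro integral_density AE_I2 densities_nonneg h) measurable
qed

text \<open>
Values of a transport kernel outside \<open>X\<close> are arbitrary and could spoil measurability, so they are
replaced by the null measure. This changes no integral with respect to \<open>\<mu>\<close>, which is carried by \<open>X\<close>.
\<close>
lemma borel_kernel_extension:
  assumes "q \<in> transport_kernels X Y \<mu> \<nu>"
  shows "borel_kernel (\<lambda>x. if x \<in> X then q x else null_measure borel) \<mu> \<nu> Y"
proof (rule borel_kernel.intro)
  have q: "\<And>x. x \<in> X \<Longrightarrow> q x \<in> borel_finite_on Y"
    "\<And>A. A \<in> sets borel \<Longrightarrow> (\<lambda>x. emeasure (q x) A) \<in> borel_measurable (restrict_space borel X)"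
    "\<And>A. A \<in> sets borel \<Longrightarrow> (\<integral>\<^sup>+x. emeasure (q x) A \<partial>\<mu>) = emeasure \<nu> A"
    using assms by (auto simp: transport_kernels_def nonneg_kernels_def)
  have X: "X \<in> sets borel" using compact_X by (simp add: borel_compact)
  let ?q = "\<lambda>x. if x \<in> X then q x else null_measure borel"
  show "sets (?q x) = sets borel" for x using q(1)[of x] by (auto simp: borel_finite_on_def)
  show "finite_measure (?q x)" for x
    using q(1)[of x] by (auto simp: borel_finite_on_def intro!: finite_measureI)
  have "AE y in null_measure borel. y \<in> Y" by (rule AE_I'[of UNIV]) (auto simp: null_sets_def)
  then show "AE y in ?q x. y \<in> Y" for x
    using q(1)[of x] by (cases "x \<in> X") (simp_all add: borel_finite_on_def)
  have em: "emeasure (?q x) A = (if x \<in> X then emeasure (q x) A else 0)" for x A by simp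
  show "(\<lambda>x. emeasure (?q x) A) \<in> borel_measurable borel" if "A \<in> sets borel" for A
    unfolding em using q(2)[OF that] X by (subst (asm) measurable_restrict_space_iff[where c=0]) auto
  show "(\<integral>\<^sup>+x. emeasure (?q x) A \<partial>\<mu>) = emeasure \<nu> A" if "A \<in> sets borel" for A
  proof -
    have "(\<integral>\<^sup>+x. emeasure (?q x) A \<partial>\<mu>) = (\<integral>\<^sup>+x. emeasure (q x) A \<partial>\<mu>)"
      by (rule nn_integral_cong_AE) (use AE_mu in eventually_elim, simp)
    then show ?thesis using q(3)[OF that] by simp
  qed
qed (use sets_mu sets_nu mu.prob_space_axioms nu.prob_space_axioms compact_Y in auto)

definition cost :: "('a \<Rightarrow> 'a) \<Rightarrow> real" where
  "cost S = (\<integral>x. (norm (x - S x))\<^sup>2 \<partial>\<mu>)"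

lemma cost_nonneg: "0 \<le> cost S"
  unfolding cost_def by (intro integral_nonneg_AE) auto

lemma sublinear_barycentre:
  assumes "h \<in> densities" "sublinear \<phi>"
  shows "(\<integral>x. \<phi> (barycentre h x) \<partial>\<mu>) \<le> (\<integral>y. \<phi> y \<partial>\<nu>)"
proof -
  interpret borel_kernel "\<lambda>x. if x \<in> X then density \<nu> (\<lambda>y. ennreal (h x y)) else null_measure borel" \<mu> \<nu> Y
    by (rule borel_kernel_extension[OF density_transport_kernel(1)[OF assms(1)]])
  have "(\<integral>x. \<phi> (barycentre h x) \<partial>\<mu>) =
      (\<integral>x. \<phi> (\<integral>y. y \<partial>(if x \<in> X then density \<nu> (\<lambda>y. ennreal (h x y)) else null_measure borel)) \<partial>\<mu>)"
  proof (rule integral_cong_AE)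
    note [measurable] = measurable_barycentre[OF assms(1)] sublinear_measurable[OF assms(2)]
    show "(\<lambda>x. \<phi> (barycentre h x)) \<in> borel_measurable \<mu>" by measurable
    show "(\<lambda>x. \<phi> (\<integral>y. y \<partial>(if x \<in> X then density \<nu> (\<lambda>y. ennreal (h x y)) else null_measure borel)))
        \<in> borel_measurable \<mu>"
      using measurable_compose[OF measurable_kernel_barycentre sublinear_measurable[OF assms(2)]]
      by (simp cong: measurable_cong_sets add: sets_mu)
    show "AE x in \<mu>. \<phi> (barycentre h x) =
        \<phi> (\<integral>y. y \<partial>(if x \<in> X then density \<nu> (\<lambda>y. ennreal (h x y)) else null_measure borel))"
      using AE_mu by eventually_elim (simp add: density_transport_kernel(2)[OF assms(1)])
  qed
  then show ?thesis using sublinear_kernel_barycentre[OF assms(2) integrable_kernel_barycentre] by simp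
qed

section \<open>The limit of a minimizing sequence\<close>

text \<open>
The parallelogram law makes a minimizing sequence Cauchy in \<open>L\<^sup>2(\<mu>)\<close>, and \<open>S\<close> is its limit. The limit
need not be the barycentre map of any kernel, so its properties are passed on from the sequence:
the optimal value, the variational inequality against every competitor, and the domination by \<open>\<nu>\<close> on
sublinear functions, which are Lipschitz.
\<close>
lemma ex_optimal_barycentre:
  obtains S where "S \<in> borel_measurable borel" "square_integrable \<mu> S"
    "\<And>e. 0 < e \<Longrightarrow> \<exists>h\<in>densities. cost (barycentre h) < cost S + e"
    "\<And>h. h \<in> densities \<Longrightarrow> (\<integral>x. (x - S x) \<bullet> (barycentre h x - S x) \<partial>\<mu>) \<le> 0"
    "\<And>\<phi>. sublinear \<phi> \<Longrightarrow> (\<integral>x. \<phi> (S x) \<partial>\<mu>) \<le> (\<integral>y. \<phi> y \<partial>\<nu>)"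
proof -
  define m where "m = (INF h\<in>densities. cost (barycentre h))"
  have bdd: "bdd_below ((\<lambda>h. cost (barycentre h)) ` densities)"
    using cost_nonneg by (intro bdd_belowI2[where m=0]) auto
  have m_le: "m \<le> cost (barycentre h)" if "h \<in> densities" for h
    unfolding m_def by (rule cINF_lower[OF bdd that])
  have "\<exists>h\<in>densities. cost (barycentre h) < m + e" if "0 < e" for e
    using cInf_lessD[of "(\<lambda>h. cost (barycentre h)) ` densities" "m + e"] one_in_densities that
    unfolding m_def by auto
  then have "\<forall>k. \<exists>h. h \<in> densities \<and> cost (barycentre h) < m + (1/4)^k / 4"
    by (metis zero_less_power zero_less_divide_iff zero_less_numeral zero_less_one)
  then obtain H where H: "\<And>k. H k \<in> densities" "\<And>k. cost (barycentre (H k)) < m + (1/4)^k / 4"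
    by metis
  define f where "f k = barycentre (H k)" for k
  have f_sq: "square_integrable \<mu> (f k)" for k
    unfolding f_def by (rule square_integrable_barycentre[OF H(1)])
  note id_sq = square_integrable_id
  have Cauchy: "(\<integral>x. (norm (f j x - f k x))\<^sup>2 \<partial>\<mu>) \<le> (1/4)^j" if "j \<le> k" for j k
  proof -
    \<comment> \<open>The midpoint density is a competitor, so the parallelogram law bounds the distance.\<close>
    let ?h = "\<lambda>x y. (1 - 1/2) * H j x y + 1/2 * H k x y"
    have h: "?h \<in> densities" "barycentre ?h x = (1 - 1/2) *\<^sub>R f j x + (1/2) *\<^sub>R f k x" for x
      unfolding f_def by (rule densities_convex; simp add: H)+
    have par: "(norm (f j x - f k x))\<^sup>2
        = 2 * (norm (x - f j x))\<^sup>2 + 2 * (norm (x - f k x))\<^sup>2 - 4 * (norm (x - barycentre ?h x))\<^sup>2" for x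
      unfolding h(2) power2_norm_eq_inner by (simp add: inner_simps inner_commute algebra_simps)
    have i: "integrable \<mu> (\<lambda>x. (norm (x - f i x))\<^sup>2)" for i
      by (intro square_integrable_norm_square square_integrable_diff id_sq f_sq)
    have ih: "integrable \<mu> (\<lambda>x. (norm (x - barycentre ?h x))\<^sup>2)"
      by (intro square_integrable_norm_square square_integrable_diff id_sq square_integrable_barycentre h(1))
    have "(\<integral>x. (norm (f j x - f k x))\<^sup>2 \<partial>\<mu>) = 2 * cost (f j) + 2 * cost (f k) - 4 * cost (barycentre ?h)"
      unfolding par cost_def using i ih by simp
    also have "\<dots> \<le> 2 * (m + (1/4)^j / 4) + 2 * (m + (1/4)^k / 4) - 4 * m"
      using H(2)[of j] H(2)[of k] m_le[OF h(1)] by (simp add: f_def)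
    also have "\<dots> \<le> (1/4)^j"
      using power_decreasing[OF that, of "1/4::real"] by (simp add: power_one_over)
    finally show ?thesis .
  qed
  have f_meas [measurable]: "f k \<in> borel_measurable borel" for k
    unfolding f_def by (rule measurable_barycentre[OF H(1)])
  obtain F where F0: "F \<in> borel_measurable \<mu>"
      "\<And>j. (\<integral>\<^sup>+x. ennreal ((norm (f j x - F x))\<^sup>2) \<partial>\<mu>) \<le> ennreal ((1/4)^j)"
  proof (rule mu.L2_limit_of_fast_Cauchy[of f])
    show "f k \<in> borel_measurable \<mu>" for k by measurable
    show "(\<integral>\<^sup>+x. ennreal ((norm (f j x - f k x))\<^sup>2) \<partial>\<mu>) \<le> ennreal ((1/4)^j)" if "j \<le> k" for j k
      by (subst nn_integral_norm_square) (auto intro!: ennreal_leI Cauchy that square_integrable_diff f_sq)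
  qed blast
  have F [measurable]: "F \<in> borel_measurable borel"
    using F0(1) by (simp cong: measurable_cong_sets add: sets_mu)
  have d_sq: "square_integrable \<mu> (\<lambda>x. f j x - F x)" for j
  proof (rule square_integrableI_nn_integral)
    show "(\<lambda>x. f j x - F x) \<in> borel_measurable \<mu>" by measurable
    show "(\<integral>\<^sup>+x. ennreal ((norm (f j x - F x))\<^sup>2) \<partial>\<mu>) < \<infinity>"
      using F0(2)[of j] by (rule order.strict_trans1) simp
  qed
  have d_le: "(\<integral>x. (norm (f j x - F x))\<^sup>2 \<partial>\<mu>) \<le> (1/4)^j" for j
    using F0(2)[of j] unfolding nn_integral_norm_square[OF d_sq] by simp
  have F_sq: "square_integrable \<mu> F"
    using square_integrable_diff[OF f_sq[of 0] d_sq[of 0]] by simp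
  have quarter: "(\<lambda>j. (1/4::real)^j) \<longlonglongrightarrow> 0" by (intro LIMSEQ_realpow_zero) auto
  have d_lim: "(\<lambda>j. \<integral>x. (norm (f j x - F x))\<^sup>2 \<partial>\<mu>) \<longlonglongrightarrow> 0"
    by (rule tendsto_sandwich[OF _ _ tendsto_const quarter])
      (auto intro!: always_eventually d_le integral_nonneg_AE)
  \<comment> \<open>Multiples of \<open>f j - F\<close> are negligible, so inequalities for \<open>f j\<close> pass to \<open>F\<close>.\<close>
  have lim: "(\<lambda>j. \<integral>x. (norm (a x + s *\<^sub>R (f j x - F x)))\<^sup>2 \<partial>\<mu>) \<longlonglongrightarrow> (\<integral>x. (norm (a x))\<^sup>2 \<partial>\<mu>)"
    if "square_integrable \<mu> a" for a :: "'a \<Rightarrow> 'a" and s :: real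
  proof (rule integral_norm_square_add_perturbation_tendsto[OF that square_integrable_scaleR[OF d_sq]])
    have "(\<lambda>j. s\<^sup>2 * (\<integral>x. (norm (f j x - F x))\<^sup>2 \<partial>\<mu>)) \<longlonglongrightarrow> s\<^sup>2 * 0"
      by (intro tendsto_mult tendsto_const d_lim)
    then show "(\<lambda>j. \<integral>x. (norm (s *\<^sub>R (f j x - F x)))\<^sup>2 \<partial>\<mu>) \<longlonglongrightarrow> 0"
      by (simp add: power_mult_distrib)
  qed
  have g_sq: "square_integrable \<mu> (\<lambda>x. x - F x)" by (intro square_integrable_diff id_sq F_sq)
  have cost_F: "cost F = m"
  proof -
    have "(\<lambda>j. cost (f j)) \<longlonglongrightarrow> cost F"
      using lim[OF g_sq, of "-1"] unfolding cost_def by simp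
    moreover have "(\<lambda>j. cost (f j)) \<longlonglongrightarrow> m"
    proof (rule tendsto_sandwich[OF _ _ tendsto_const])
      show "\<forall>\<^sub>F j in sequentially. m \<le> cost (f j)"
        unfolding f_def by (intro always_eventually allI m_le H(1))
      show "\<forall>\<^sub>F j in sequentially. cost (f j) \<le> m + (1/4)^j / 4"
        unfolding f_def by (intro always_eventually allI less_imp_le H(2))
      have "(\<lambda>j. m + (1/4)^j / 4) \<longlonglongrightarrow> m + 0 / 4" by (intro tendsto_intros quarter) simp
      then show "(\<lambda>j. m + (1/4)^j / 4) \<longlonglongrightarrow> m" by simp
    qed
    ultimately show ?thesis by (rule LIMSEQ_unique)
  qed
  show ?thesis
  proof (rule that[OF F F_sq])
    show "\<exists>h\<in>densities. cost (barycentre h) < cost F + e" if "0 < e" for e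
      using cInf_lessD[of "(\<lambda>h. cost (barycentre h)) ` densities" "m + e"] one_in_densities that
      unfolding cost_F m_def by auto
  next
    fix h assume h: "h \<in> densities"
    let ?v = "\<lambda>x. barycentre h x - F x"
    let ?I = "\<integral>x. (x - F x) \<bullet> ?v x \<partial>\<mu>" and ?V = "\<integral>x. (norm (?v x))\<^sup>2 \<partial>\<mu>"
    have v_sq: "square_integrable \<mu> ?v" by (intro square_integrable_diff square_integrable_barycentre h F_sq)
    have V: "0 \<le> ?V" by (intro integral_nonneg_AE) auto
    have step: "2 * ?I \<le> t * ?V" if t: "0 < t" "t \<le> 1" for t
    proof -
      let ?hj = "\<lambda>j x y. (1 - t) * H j x y + t * h x y"
      have hj: "?hj j \<in> densities" "barycentre (?hj j) x = (1 - t) *\<^sub>R f j x + t *\<^sub>R barycentre h x" for j x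
        unfolding f_def using t by (intro densities_convex H(1) h; simp)+
      have sq: "square_integrable \<mu> (\<lambda>x. (x - F x) + (- t) *\<^sub>R ?v x)"
        by (intro square_integrable_add g_sq square_integrable_scaleR v_sq)
      have "m \<le> (\<integral>x. (norm ((x - F x) + (- t) *\<^sub>R ?v x))\<^sup>2 \<partial>\<mu>)"
      proof (rule LIMSEQ_le_const[OF lim[OF sq, of "t - 1"]], intro exI allI impI)
        fix j
        have "x - barycentre (?hj j) x = (x - F x) + (- t) *\<^sub>R ?v x + (t - 1) *\<^sub>R (f j x - F x)" for x
          unfolding hj(2) by (simp add: algebra_simps)
        then show "m \<le> (\<integral>x. (norm ((x - F x) + (- t) *\<^sub>R ?v x + (t - 1) *\<^sub>R (f j x - F x)))\<^sup>2 \<partial>\<mu>)"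
          using m_le[OF hj(1), of j] unfolding cost_def by (simp only:)
      qed
      also have "\<dots> = cost F + 2 * (\<integral>x. (x - F x) \<bullet> ((- t) *\<^sub>R ?v x) \<partial>\<mu>)
          + (\<integral>x. (norm ((- t) *\<^sub>R ?v x))\<^sup>2 \<partial>\<mu>)"
        unfolding cost_def by (rule integral_norm_square_add[OF g_sq square_integrable_scaleR[OF v_sq]])
      also have "\<dots> = m - 2 * t * ?I + t\<^sup>2 * ?V"
        unfolding cost_F by (simp add: power_mult_distrib)
      finally have "t * (2 * ?I) \<le> t * (t * ?V)" by (simp add: power2_eq_square)
      then show ?thesis using t(1) by (rule mult_left_le_imp_le)
    qed
    show "?I \<le> 0"
    proof (rule ccontr)
      assume "\<not> ?I \<le> 0"
      then have I: "0 < ?I" by simp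
      \<comment> \<open>The slope \<open>?I\<close> at \<open>t = 0\<close> dominates the quadratic term for this small \<open>t\<close>.\<close>
      define t where "t = min 1 (?I / (?V + 1))"
      have V1: "0 < ?V + 1" using V by linarith
      have t: "0 < t" "t \<le> 1" using divide_pos_pos[OF I V1] by (auto simp: t_def)
      have "t * ?V \<le> ?I / (?V + 1) * (?V + 1)"
        using divide_pos_pos[OF I V1] V by (intro mult_mono) (auto simp: t_def)
      also have "\<dots> = ?I" using V1 by simp
      finally show False using step[OF t] I by simp
    qed
  next
    fix \<phi> :: "'a \<Rightarrow> real" assume s: "sublinear \<phi>"
    obtain L where L: "0 \<le> L" "\<And>x. \<bar>\<phi> x\<bar> \<le> L * norm x" using sublinear_bounded[OF s] by blast
    have "(\<integral>x. \<phi> (F x) \<partial>\<mu>) \<le> (\<integral>y. \<phi> y \<partial>\<nu>) + L * (1/2)^j" for j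
    proof -
      have d1: "(\<integral>x. norm (F x - f j x) \<partial>\<mu>) \<le> (1/2)^j"
      proof -
        let ?s = "(1/2)^j :: real"
        have s: "0 < ?s" "?s * ?s = (1/4)^j" by (auto simp flip: power_mult_distrib)
        have i: "integrable \<mu> (\<lambda>x. norm (F x - f j x))"
          by (intro integrable_norm mu.square_integrable_imp_integrable square_integrable_diff F_sq f_sq)
        have "(\<integral>x. 2 * ?s * norm (F x - f j x) \<partial>\<mu>) \<le> (\<integral>x. ?s\<^sup>2 + (norm (f j x - F x))\<^sup>2 \<partial>\<mu>)"
        proof (rule integral_mono)
          show "integrable \<mu> (\<lambda>x. ?s\<^sup>2 + (norm (f j x - F x))\<^sup>2)"
            by (intro Bochner_Integration.integrable_add square_integrable_norm_square d_sq) simp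
          show "2 * ?s * norm (F x - f j x) \<le> ?s\<^sup>2 + (norm (f j x - F x))\<^sup>2" for x
            using sum_squares_bound[of ?s "norm (F x - f j x)"] by (simp only: norm_minus_commute)
        qed (use i in simp)
        also have "\<dots> = ?s\<^sup>2 + (\<integral>x. (norm (f j x - F x))\<^sup>2 \<partial>\<mu>)"
          by (subst Bochner_Integration.integral_add)
            (auto intro: square_integrable_norm_square d_sq simp: mu.prob_space)
        also have "\<dots> \<le> 2 * ?s * ?s"
          using d_le[of j] s(2) by (simp add: power2_eq_square)
        finally have "2 * ?s * (\<integral>x. norm (F x - f j x) \<partial>\<mu>) \<le> 2 * ?s * ?s"
          by simp
        then show ?thesis by (rule mult_left_le_imp_le) (use s in simp)
      qed
      have i: "integrable \<mu> F" "integrable \<mu> (f j)"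
        using mu.square_integrable_imp_integrable F_sq f_sq by blast+
      have "(\<integral>x. \<phi> (F x) \<partial>\<mu>) \<le> (\<integral>x. \<phi> (f j x) + L * norm (F x - f j x) \<partial>\<mu>)"
        using i by (intro integral_mono sublinear_diff_le[OF s L(2)] sublinear_integrable[OF s]
            Bochner_Integration.integrable_add integrable_mult_right integrable_norm Bochner_Integration.integrable_diff)
      also have "\<dots> = (\<integral>x. \<phi> (f j x) \<partial>\<mu>) + L * (\<integral>x. norm (F x - f j x) \<partial>\<mu>)"
        using i by (subst Bochner_Integration.integral_add) (auto intro: sublinear_integrable[OF s])
      also have "\<dots> \<le> (\<integral>y. \<phi> y \<partial>\<nu>) + L * (1/2)^j"
        unfolding f_def[of j] using L(1) d1 sublinear_barycentre[OF H(1) s, of j]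
        by (intro add_mono mult_left_mono) (auto simp: f_def)
      finally show ?thesis .
    qed
    moreover have "(\<lambda>j. (\<integral>y. \<phi> y \<partial>\<nu>) + L * (1/2)^j) \<longlonglongrightarrow> (\<integral>y. \<phi> y \<partial>\<nu>) + L * 0"
      by (intro tendsto_intros LIMSEQ_realpow_zero) auto
    ultimately show "(\<integral>x. \<phi> (F x) \<partial>\<mu>) \<le> (\<integral>y. \<phi> y \<partial>\<nu>)"
      by (intro LIMSEQ_le_const[where X="\<lambda>j. (\<integral>y. \<phi> y \<partial>\<nu>) + L * (1/2)^j"]) auto
  qed
qed

end

section \<open>The potential\<close>

text \<open>
What the rest of the proof uses of the limit \<open>S\<close> of a minimizing sequence.
\<close>
locale optimal_barycentre = compact_marginals +
  fixes S :: "'a \<Rightarrow> 'a"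
  assumes S_measurable [measurable]: "S \<in> borel_measurable borel"
    and S_square_integrable: "square_integrable \<mu> S"
    and cost_approx: "\<And>e. 0 < e \<Longrightarrow> \<exists>h\<in>densities. cost (barycentre h) < cost S + e"
    and first_order: "\<And>h. h \<in> densities \<Longrightarrow> (\<integral>x. (x - S x) \<bullet> (barycentre h x - S x) \<partial>\<mu>) \<le> 0"
    and sublinear_S: "\<And>\<phi>. sublinear \<phi> \<Longrightarrow> (\<integral>x. \<phi> (S x) \<partial>\<mu>) \<le> (\<integral>y. \<phi> y \<partial>\<nu>)"
begin

lemma integrable_S: "integrable \<mu> S"
  by (rule mu.square_integrable_imp_integrable[OF S_square_integrable])

lemma residual_square_integrable: "square_integrable \<mu> (\<lambda>x. x - S x)"
  by (intro square_integrable_diff square_integrable_id S_square_integrable)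

definition average :: "'a set \<Rightarrow> 'a" where
  "average B = (1 / measure \<mu> B) *\<^sub>R (\<integral>x. indicator B x *\<^sub>R (x - S x) \<partial>\<mu>)"

text \<open>
The first-order condition is tested with the kernel that spreads the mass at \<open>y\<close> uniformly over
\<open>B i\<close>, where \<open>i\<close> maximizes the inner product of \<open>y\<close> with the averages. Exchanging the order of
integration turns \<open>\<integral> (x - S x) \<bullet> barycentre h x d\<mu>\<close> into the left-hand side exactly, because averaging the
residual over \<open>B i\<close> is what integrating against \<open>h\<close> does.
\<close>
lemma max_inner_averages_le:
  assumes B [measurable]: "\<And>i. B i \<in> sets borel" and pos: "\<And>i. 0 < measure \<mu> (B i)"
  shows "(\<integral>y. max_inner (\<lambda>i. average (B i)) k y \<partial>\<nu>) \<le> (\<integral>x. (x - S x) \<bullet> S x \<partial>\<mu>)"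
proof -
  let ?c = "\<lambda>i. average (B i)" and ?g = "\<lambda>x. x - S x"
  define h where "h x y = indicator (B (argmax_inner ?c k y)) x / measure \<mu> (B (argmax_inner ?c k y))" for x y :: 'a
  have h_measurable [measurable]: "case_prod h \<in> borel_measurable (borel \<Otimes>\<^sub>M borel)"
  proof -
    have "(\<lambda>p. (\<lambda>i p. indicator (B i) (fst p) / measure \<mu> (B i) :: real) (argmax_inner ?c k (snd p)) p)
        \<in> borel_measurable (borel \<Otimes>\<^sub>M borel)"
      by (rule measurable_compose_countable) measurable
    then show ?thesis by (simp add: h_def split_beta')
  qed
  define b where "b = (\<Sum>i\<le>k. 1 / measure \<mu> (B i))"
  have h_bounds: "0 \<le> h x y" "h x y \<le> b" for x y
  proof -
    have "h x y \<le> 1 / measure \<mu> (B (argmax_inner ?c k y))"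
      unfolding h_def by (intro divide_right_mono) (auto simp: indicator_def)
    also have "\<dots> \<le> b"
      unfolding b_def by (rule member_le_sum) (auto simp: argmax_inner_le)
    finally show "h x y \<le> b" .
  qed (simp add: h_def)
  have h: "h \<in> densities"
    unfolding densities_def
  proof (intro CollectI conjI allI)
    show "\<exists>b. \<forall>x y. 0 \<le> h x y \<and> h x y \<le> b" using h_bounds by blast
    show "(\<integral>x. h x y \<partial>\<mu>) = 1" for y
      using pos[of "argmax_inner ?c k y"] by (simp add: h_def)
  qed (rule h_measurable)
  have g_int: "integrable \<mu> ?g"
    by (rule mu.square_integrable_imp_integrable[OF residual_square_integrable])
  obtain R where R: "0 \<le> R" "AE y in \<nu>. norm y \<le> R" using norm_bounded_AE[OF compact_Y AE_nu] by blast
  let ?F = "\<lambda>x y. h x y * (?g x \<bullet> y)"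
  have F_bound: "AE y in \<nu>. norm (?F x y) \<le> b * R * norm (?g x)" for x
    using R(2)
  proof eventually_elim
    case (elim y)
    have "\<bar>?g x \<bullet> y\<bar> \<le> norm (?g x) * norm y" by (rule Cauchy_Schwarz_ineq2)
    also have "\<dots> \<le> norm (?g x) * R" using elim by (intro mult_left_mono) auto
    finally have "h x y * \<bar>?g x \<bullet> y\<bar> \<le> b * (norm (?g x) * R)"
      using h_bounds[of x y] by (intro mult_mono) (auto intro: order_trans)
    then show ?case using h_bounds(1)[of x y] by (simp add: abs_mult mult_ac)
  qed
  have F_int: "integrable \<nu> (?F x)" for x
    using F_bound[of x] by (intro nu.integrable_const_bound) auto
  have pair: "integrable (\<mu> \<Otimes>\<^sub>M \<nu>) (case_prod ?F)"
  proof (rule product.Fubini_integrable)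
    show "case_prod ?F \<in> borel_measurable (\<mu> \<Otimes>\<^sub>M \<nu>)" by measurable
    show "AE x in \<mu>. integrable \<nu> (\<lambda>y. case (x, y) of (x, y) \<Rightarrow> ?F x y)"
      using F_int by simp
    show "integrable \<mu> (\<lambda>x. \<integral>y. norm (case (x, y) of (x, y) \<Rightarrow> ?F x y) \<partial>\<nu>)"
    proof (rule Bochner_Integration.integrable_bound)
      show "integrable \<mu> (\<lambda>x. b * R * norm (?g x))" using g_int by simp
      show "(\<lambda>x. \<integral>y. norm (case (x, y) of (x, y) \<Rightarrow> ?F x y) \<partial>\<nu>) \<in> borel_measurable \<mu>" by measurable
      show "AE x in \<mu>. norm (\<integral>y. norm (case (x, y) of (x, y) \<Rightarrow> ?F x y) \<partial>\<nu>) \<le> norm (b * R * norm (?g x))"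
      proof (rule AE_I2)
        fix x
        have "(\<integral>y. norm (?F x y) \<partial>\<nu>) \<le> (\<integral>y. b * R * norm (?g x) \<partial>\<nu>)"
          by (intro integral_mono_AE F_bound integrable_norm F_int) simp
        moreover have "0 \<le> (\<integral>y. norm (?F x y) \<partial>\<nu>)" by (intro integral_nonneg_AE) simp
        ultimately show "norm (\<integral>y. norm (case (x, y) of (x, y) \<Rightarrow> ?F x y) \<partial>\<nu>) \<le> norm (b * R * norm (?g x))"
          by (simp add: nu.prob_space)
      qed
    qed
  qed
  have "(\<integral>x. ?g x \<bullet> barycentre h x \<partial>\<mu>) = (\<integral>x. (\<integral>y. ?F x y \<partial>\<nu>) \<partial>\<mu>)"
  proof (rule Bochner_Integration.integral_cong[OF refl])
    fix x
    have "?g x \<bullet> barycentre h x = (\<integral>y. ?g x \<bullet> (h x y *\<^sub>R y) \<partial>\<nu>)"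
      unfolding barycentre_def by (rule integral_inner_right[symmetric]) (rule integrable_density_barycentre[OF h])
    then show "?g x \<bullet> barycentre h x = (\<integral>y. ?F x y \<partial>\<nu>)" by simp
  qed
  also have "\<dots> = (\<integral>y. (\<integral>x. ?F x y \<partial>\<mu>) \<partial>\<nu>)"
    by (rule product.Fubini_integral[OF pair, symmetric])
  also have "\<dots> = (\<integral>y. max_inner ?c k y \<partial>\<nu>)"
  proof (rule Bochner_Integration.integral_cong[OF refl])
    fix y
    let ?B = "B (argmax_inner ?c k y)"
    have i: "integrable \<mu> (\<lambda>x. indicator ?B x *\<^sub>R ?g x)"
      using g_int by (intro integrable_mult_indicator) auto
    have "(\<integral>x. ?F x y \<partial>\<mu>) = (\<integral>x. (1 / measure \<mu> ?B) * ((indicator ?B x *\<^sub>R ?g x) \<bullet> y) \<partial>\<mu>)"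
      by (simp add: h_def)
    also have "\<dots> = (1 / measure \<mu> ?B) * ((\<integral>x. indicator ?B x *\<^sub>R ?g x \<partial>\<mu>) \<bullet> y)"
      unfolding integral_mult_right_zero using i by (subst integral_inner_left) auto
    also have "\<dots> = max_inner ?c k y" by (simp add: average_def)
    finally show "(\<integral>x. ?F x y \<partial>\<mu>) = max_inner ?c k y" .
  qed
  finally have eq: "(\<integral>x. ?g x \<bullet> barycentre h x \<partial>\<mu>) = (\<integral>y. max_inner ?c k y \<partial>\<nu>)" .
  have "(\<integral>x. ?g x \<bullet> barycentre h x \<partial>\<mu>) - (\<integral>x. ?g x \<bullet> S x \<partial>\<mu>) = (\<integral>x. ?g x \<bullet> (barycentre h x - S x) \<partial>\<mu>)"
    unfolding inner_diff_right[of "_ - S _" "barycentre h _"]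
    by (intro Bochner_Integration.integral_diff[symmetric] integrable_inner_square_integrable
        residual_square_integrable square_integrable_barycentre h S_square_integrable)
  then show ?thesis using first_order[OF h] eq by simp
qed

lemma ex_potential:
  obtains c :: "nat \<Rightarrow> 'a" where "AE x in \<mu>. x - S x \<in> closure (range c)"
    "\<And>k. (\<integral>y. max_inner c k y \<partial>\<nu>) \<le> (\<integral>x. (x - S x) \<bullet> S x \<partial>\<mu>)"
proof -
  have ne: "emeasure \<mu> (space \<mu>) \<noteq> 0" by (simp add: mu.emeasure_space_1)
  note int = mu.square_integrable_imp_integrable[OF residual_square_integrable]
  show ?thesis
  proof (rule mu.AE_in_closure_averages[OF int ne])
    fix B :: "nat \<Rightarrow> 'a set"
    assume B: "\<And>i. B i \<in> sets \<mu>" "\<And>i. measure \<mu> (B i) > 0"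
      "AE x in \<mu>. x - S x \<in> closure (range (\<lambda>i. (1 / measure \<mu> (B i)) *\<^sub>R (\<integral>x. indicator (B i) x *\<^sub>R (x - S x) \<partial>\<mu>)))"
    show thesis
    proof (rule that[of "\<lambda>i. average (B i)"])
      show "AE x in \<mu>. x - S x \<in> closure (range (\<lambda>i. average (B i)))"
        using B(3) by (simp add: average_def)
      show "(\<integral>y. max_inner (\<lambda>i. average (B i)) k y \<partial>\<nu>) \<le> (\<integral>x. (x - S x) \<bullet> S x \<partial>\<mu>)" for k
        using B(1,2) by (intro max_inner_averages_le) (simp_all add: sets_mu)
    qed
  qed
qed

end

section \<open>Optimality and projection\<close>

lemma half_ennreal: "ennreal (1/2 * a) = 1/2 * ennreal a"
  by (subst ennreal_mult') (simp_all add: divide_ennreal_def)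

lemma half_ennreal_cancel: "1/2 * a = 1/2 * b \<longleftrightarrow> a = (b :: ennreal)"
  by (subst ennreal_mult_cancel_left) (simp add: divide_ennreal_def)

text \<open>
The supremum over \<open>i\<close> of the linear functions \<open>c i \<bullet> y\<close> is the dual potential. It is the support
function of the set \<open>C\<close> below.
\<close>
locale optimal_potential = optimal_barycentre +
  fixes c :: "nat \<Rightarrow> 'a"
  assumes residual_in_closure: "AE x in \<mu>. x - S x \<in> closure (range c)"
    and max_inner_le: "\<And>k. (\<integral>y. max_inner c k y \<partial>\<nu>) \<le> (\<integral>x. (x - S x) \<bullet> S x \<partial>\<mu>)"
begin

definition C :: "'a set" where "C = closure (convex hull (range c))"

lemma C_closed: "closed C" and C_convex: "convex C" and C_nonempty: "C \<noteq> {}"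
  by (auto simp: C_def convex_closure convex_convex_hull)

text \<open>
Integrating \<open>max (c i \<bullet> S x) ((x - S x) \<bullet> S x)\<close>, which stays below the potential at \<open>S x\<close>, gives at
most the integral of its second argument. So the maximum equals the second argument almost everywhere.
\<close>
lemma residual_attains_support: "AE x in \<mu>. \<forall>i. c i \<bullet> S x \<le> (x - S x) \<bullet> S x"
proof (subst AE_all_countable, rule allI)
  fix i
  let ?g = "\<lambda>x. x - S x"
  let ?u = "\<lambda>x. max (c i \<bullet> S x) (?g x \<bullet> S x)"
  have ig: "integrable \<mu> (\<lambda>x. ?g x \<bullet> S x)"
    by (intro integrable_inner_square_integrable residual_square_integrable S_square_integrable)
  have iu: "integrable \<mu> ?u"
    using ig integrable_S by (intro integrable_max integrable_inner_right) auto
  have "(\<integral>x. ?u x \<partial>\<mu>) \<le> (\<integral>x. ?g x \<bullet> S x \<partial>\<mu>)"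
  proof (rule integral_le_of_le_SUP_max_inner[OF integrable_S iu])
    show "(\<integral>x. max_inner c k (S x) \<partial>\<mu>) \<le> (\<integral>x. ?g x \<bullet> S x \<partial>\<mu>)" for k
      using sublinear_S[OF sublinear_max_inner, of c k] max_inner_le[of k] by simp
    show "AE x in \<mu>. \<forall>e>0. \<exists>k. ?u x - e < max_inner c k (S x)"
      using residual_in_closure
    proof eventually_elim
      case (elim x)
      show ?case
      proof (intro allI impI)
        fix e :: real assume e: "0 < e"
        show "\<exists>k. ?u x - e < max_inner c k (S x)"
        proof (cases "c i \<bullet> S x \<le> ?g x \<bullet> S x")
          case True
          then show ?thesis using inner_le_max_inner_of_closure[OF elim e, of "S x"] by (simp add: max_def)
        next
          case False
          then have "?u x - e < max_inner c i (S x)"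
            using inner_le_max_inner[of i i c "S x"] e by simp
          then show ?thesis ..
        qed
      qed
    qed
  qed
  then have "(\<integral>x. ?u x - ?g x \<bullet> S x \<partial>\<mu>) \<le> 0" using iu ig by simp
  moreover have nn: "0 \<le> ?u x - ?g x \<bullet> S x" for x by simp
  ultimately have "(\<integral>x. ?u x - ?g x \<bullet> S x \<partial>\<mu>) = 0"
    by (intro antisym integral_nonneg_AE AE_I2)
  then have "AE x in \<mu>. ?u x - ?g x \<bullet> S x = 0"
    using nn by (subst (asm) integral_nonneg_eq_0_iff_AE) (auto intro: iu ig)
  then show "AE x in \<mu>. c i \<bullet> S x \<le> ?g x \<bullet> S x" by eventually_elim linarith
qed

text \<open>
The inequality \<open>S x \<bullet> a \<le> S x \<bullet> (x - S x)\<close> passes from the points \<open>c i\<close> to all \<open>a \<in> C\<close>, as half-spaces are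
closed and convex. Since \<open>S x = x - (x - S x)\<close>, it is the variational inequality for the closest
point.
\<close>
lemma residual_eq_projection: "AE x in \<mu>. S x = x - closest_point C x"
  using residual_attains_support residual_in_closure
proof eventually_elim
  case (elim x)
  let ?g = "x - S x"
  have "range c \<subseteq> {a. S x \<bullet> a \<le> S x \<bullet> ?g}" using elim(1) by (auto simp: inner_commute)
  then have "convex hull (range c) \<subseteq> {a. S x \<bullet> a \<le> S x \<bullet> ?g}"
    by (rule hull_minimal) (rule convex_halfspace_le)
  then have C: "C \<subseteq> {a. S x \<bullet> a \<le> S x \<bullet> ?g}"
    unfolding C_def by (rule closure_minimal) (rule closed_halfspace_le)
  have norm_square_add: "(norm (u + w))\<^sup>2 = (norm u)\<^sup>2 + 2 * (u \<bullet> w) + (norm w)\<^sup>2" for u w :: 'a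
    unfolding power2_norm_eq_inner by (simp add: inner_add_left inner_add_right inner_commute)
  have "?g \<in> C"
    using elim(2) closure_mono[OF hull_subset[of "range c" convex]] by (auto simp: C_def)
  moreover have "dist x ?g \<le> dist x a" if "a \<in> C" for a
  proof -
    have "S x \<bullet> a \<le> S x \<bullet> ?g" using C that by blast
    then have *: "0 \<le> S x \<bullet> (?g - a)" by (simp add: inner_diff_right)
    have "(norm (x - a))\<^sup>2 = (norm (S x + (?g - a)))\<^sup>2" by simp
    also have "\<dots> = (norm (S x))\<^sup>2 + 2 * (S x \<bullet> (?g - a)) + (norm (?g - a))\<^sup>2"
      by (rule norm_square_add)
    finally have "(norm (S x))\<^sup>2 \<le> (norm (x - a))\<^sup>2" using * by simp
    then show ?thesis by (simp add: dist_norm)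
  qed
  ultimately have "?g = closest_point C x"
    by (intro closest_point_unique C_convex C_closed) auto
  then show ?case by (simp add: algebra_simps)
qed

text \<open>
Expand \<open>x - z = (x - S x) + (S x - z)\<close>. The cross term is nonnegative: \<open>(x - S x) \<bullet> z\<close> is at most the
potential at \<open>z\<close>, and the finite maxima that increase to the potential are sublinear, so their
integrals against \<open>\<eta>\<close> are bounded by those against \<open>\<nu>\<close>.
\<close>
lemma coupling_cost_lower_bound:
  assumes \<pi>: "\<pi> \<in> couplings \<mu> \<eta>" and \<eta>: "le_phc \<eta> \<nu>"
  shows "ennreal (cost S) + (\<integral>\<^sup>+p. ennreal ((norm (S (fst p) - snd p))\<^sup>2) \<partial>\<pi>)
    \<le> (\<integral>\<^sup>+p. ennreal ((norm (fst p - snd p))\<^sup>2) \<partial>\<pi>)"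
proof (cases "(\<integral>\<^sup>+p. ennreal ((norm (fst p - snd p))\<^sup>2) \<partial>\<pi>) < \<infinity>")
  case False
  then show ?thesis by (simp add: not_less top_unique)
next
  case True
  note marg = coupling_marginals[OF \<pi>]
  have [measurable]: "fst \<in> borel_measurable \<pi>" "snd \<in> borel_measurable \<pi>"
    using marg(2,3) by (simp_all cong: measurable_cong_sets add: measurable_cong_sets[OF refl sets_mu])
  interpret p: prob_space \<pi> by (rule marg(6))
  let ?g = "\<lambda>p. fst p - S (fst p)"
  have diff_sq: "square_integrable \<pi> (\<lambda>p. fst p - snd p)"
    using True by (intro square_integrableI_nn_integral) auto
  have snd_sq: "square_integrable \<pi> snd"
    using square_integrable_diff[OF square_integrable_fst(1)[OF \<pi> square_integrable_id] diff_sq] by simp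
  have snd_int: "integrable \<pi> snd" by (rule p.square_integrable_imp_integrable[OF snd_sq])
  have S_sq: "square_integrable \<pi> (\<lambda>p. S (fst p))" by (rule square_integrable_fst(1)[OF \<pi> S_square_integrable])
  have g_sq: "square_integrable \<pi> ?g"
    "(\<integral>p. (norm (?g p))\<^sup>2 \<partial>\<pi>) = cost S"
    using square_integrable_fst[OF \<pi> residual_square_integrable] by (simp_all add: cost_def)
  have d_sq: "square_integrable \<pi> (\<lambda>p. S (fst p) - snd p)" by (intro square_integrable_diff S_sq snd_sq)
  have gs: "integrable \<pi> (\<lambda>p. ?g p \<bullet> snd p)" "integrable \<pi> (\<lambda>p. ?g p \<bullet> S (fst p))"
    by (intro integrable_inner_square_integrable g_sq(1) snd_sq S_sq)+
  have "(\<integral>p. ?g p \<bullet> snd p \<partial>\<pi>) \<le> (\<integral>x. (x - S x) \<bullet> S x \<partial>\<mu>)"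
  proof (rule integral_le_of_le_SUP_max_inner[OF snd_int gs(1)])
    fix k
    have "(\<integral>p. max_inner c k (snd p) \<partial>\<pi>) = (\<integral>z. max_inner c k z \<partial>\<eta>)"
      using integral_distr[OF marg(3) sublinear_measurable[OF sublinear_max_inner], of c k] unfolding marg(5) by simp
    also have "\<dots> \<le> (\<integral>y. max_inner c k y \<partial>\<nu>)"
      by (rule le_phcD[OF \<eta> sublinear_max_inner])
    finally show "(\<integral>p. max_inner c k (snd p) \<partial>\<pi>) \<le> (\<integral>x. (x - S x) \<bullet> S x \<partial>\<mu>)"
      using max_inner_le[of k] by simp
  next
    have "AE p in \<pi>. ?g p \<in> closure (range c)"
      using residual_in_closure AE_distrD[OF marg(2)] unfolding marg(4) by blast
    then show "AE p in \<pi>. \<forall>e>0. \<exists>k. ?g p \<bullet> snd p - e < max_inner c k (snd p)"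
      by eventually_elim (use inner_le_max_inner_of_closure in blast)
  qed
  also have "(\<integral>x. (x - S x) \<bullet> S x \<partial>\<mu>) = (\<integral>p. ?g p \<bullet> S (fst p) \<partial>\<pi>)"
  proof -
    have "(\<lambda>x. (x - S x) \<bullet> S x) \<in> borel_measurable \<mu>" by measurable
    from integral_distr[OF marg(2) this] show ?thesis unfolding marg(4) .
  qed
  finally have "0 \<le> (\<integral>p. ?g p \<bullet> (S (fst p) - snd p) \<partial>\<pi>)"
    unfolding inner_diff_right using gs by simp
  moreover have "(\<integral>p. (norm (fst p - snd p))\<^sup>2 \<partial>\<pi>) = cost S
      + 2 * (\<integral>p. ?g p \<bullet> (S (fst p) - snd p) \<partial>\<pi>) + (\<integral>p. (norm (S (fst p) - snd p))\<^sup>2 \<partial>\<pi>)"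
    using integral_norm_square_add[OF g_sq(1) d_sq] unfolding g_sq(2) by simp
  ultimately have "cost S + (\<integral>p. (norm (S (fst p) - snd p))\<^sup>2 \<partial>\<pi>) \<le> (\<integral>p. (norm (fst p - snd p))\<^sup>2 \<partial>\<pi>)"
    by simp
  then show ?thesis
    unfolding nn_integral_norm_square[OF diff_sq] nn_integral_norm_square[OF d_sq]
    by (subst ennreal_plus[symmetric]) (auto intro!: ennreal_leI cost_nonneg integral_nonneg_AE)
qed

lemma W2_sq_lower_bound:
  assumes "le_phc \<eta> \<nu>"
  shows "ennreal (cost S) \<le> W2_sq \<mu> \<eta>"
  unfolding W2_sq_def
proof (rule INF_greatest)
  fix \<pi> assume "\<pi> \<in> couplings \<mu> \<eta>"
  from coupling_cost_lower_bound[OF this assms]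
  have "ennreal (cost S) \<le> (\<integral>\<^sup>+p. ennreal ((norm (fst p - snd p))\<^sup>2) \<partial>\<pi>)"
    by (rule order_trans[rotated]) simp
  then show "ennreal (cost S) \<le> (\<integral>\<^sup>+(x, z). ennreal ((norm (x - z))\<^sup>2) \<partial>\<pi>)"
    by (simp add: split_beta')
qed

lemma W2_sq_S: "W2_sq \<mu> (distr \<mu> borel S) \<le> ennreal (cost S)"
proof -
  have "W2_sq \<mu> (distr \<mu> borel S) \<le> (\<integral>\<^sup>+(x, z). ennreal ((norm (x - z))\<^sup>2) \<partial>distr \<mu> borel (\<lambda>x. (x, S x)))"
    unfolding W2_sq_def by (rule INF_lower[OF graph_coupling(1)[OF S_measurable]])
  also have "\<dots> = (\<integral>\<^sup>+x. ennreal ((norm (x - S x))\<^sup>2) \<partial>\<mu>)"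
    using graph_coupling(2)[OF S_measurable borel_measurable_dist_square] by (simp add: split_beta')
  also have "\<dots> = ennreal (cost S)"
    unfolding cost_def by (rule nn_integral_norm_square[OF residual_square_integrable])
  finally show ?thesis .
qed

lemma le_phc_S: "le_phc (distr \<mu> borel S) \<nu>"
proof (intro le_phc_distrI mu.prob_space_axioms nu.prob_space_axioms integrable_S sets_nu sublinear_S)
  obtain R where "AE y in \<nu>. norm y \<le> R" using norm_bounded_AE[OF compact_Y AE_nu] by blast
  then show "integrable \<nu> (\<lambda>y. y)" by (intro nu.integrable_const_bound[where B=R]) auto
qed

lemma INF_W2_sq: "(INF \<eta>\<in>{\<eta>. le_phc \<eta> \<nu>}. W2_sq \<mu> \<eta>) = ennreal (cost S)"
proof (rule antisym)
  show "(INF \<eta>\<in>{\<eta>. le_phc \<eta> \<nu>}. W2_sq \<mu> \<eta>) \<le> ennreal (cost S)"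
    using le_phc_S W2_sq_S by (intro INF_lower2[of "distr \<mu> borel S"]) auto
  show "ennreal (cost S) \<le> (INF \<eta>\<in>{\<eta>. le_phc \<eta> \<nu>}. W2_sq \<mu> \<eta>)"
    using W2_sq_lower_bound by (intro INF_greatest) auto
qed

text \<open>
Near-optimal couplings of \<open>\<mu>\<close> and \<open>\<eta>\<close> have small \<open>\<integral> |S x - z|\<^sup>2 d\<pi>\<close>, so Lipschitz functions have the
same integral against \<open>\<eta>\<close> as against the law of \<open>S\<close>.
\<close>
lemma le_phc_optimal_unique:
  assumes \<eta>: "le_phc \<eta> \<nu>" and W: "W2_sq \<mu> \<eta> \<le> ennreal (cost S)"
  shows "\<eta> = distr \<mu> borel S"
proof (rule prob_measure_eqI_infdist)
  show "sets \<eta> = sets borel" "prob_space \<eta>"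
    using \<eta> by (auto simp: le_phc_def prob_first_moment_def borel_prob_on_def)
  show "prob_space (distr \<mu> borel S)" by (intro mu.prob_space_distr) measurable
  fix F :: "'a set" and n :: nat assume "closed F" "F \<noteq> {}"
  let ?f = "\<lambda>z. max 0 (1 - real n * infdist z F)"
  have f_meas [measurable]: "?f \<in> borel_measurable borel"
    by (intro borel_measurable_continuous_onI continuous_intros)
  have f_lip: "\<bar>?f u - ?f v\<bar> \<le> real n * norm (u - v)" for u v
  proof -
    have "\<bar>?f u - ?f v\<bar> \<le> \<bar>real n * infdist u F - real n * infdist v F\<bar>" by linarith
    also have "\<dots> = real n * \<bar>infdist u F - infdist v F\<bar>"
      by (simp add: abs_mult flip: right_diff_distrib)
    also have "\<dots> \<le> real n * norm (u - v)"
      using infdist_triangle_abs[of u F v] by (intro mult_left_mono) (auto simp: dist_norm)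
    finally show ?thesis .
  qed
  have close: "\<bar>(\<integral>z. ?f z \<partial>\<eta>) - (\<integral>z. ?f z \<partial>distr \<mu> borel S)\<bar> \<le> real n * \<delta>" if \<delta>: "0 < \<delta>" for \<delta>
  proof -
    have "W2_sq \<mu> \<eta> < ennreal (cost S + \<delta>\<^sup>2)"
      using W \<delta> cost_nonneg[of S] by (auto intro: order.strict_trans1 simp: ennreal_less_iff)
    then obtain \<pi> where \<pi>: "\<pi> \<in> couplings \<mu> \<eta>"
        "(\<integral>\<^sup>+p. ennreal ((norm (fst p - snd p))\<^sup>2) \<partial>\<pi>) < ennreal (cost S + \<delta>\<^sup>2)"
      unfolding W2_sq_def INF_less_iff by (auto simp: split_beta')
    note marg = coupling_marginals[OF \<pi>(1)]
    have [measurable]: "fst \<in> borel_measurable \<pi>" "snd \<in> borel_measurable \<pi>"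
      using marg(2,3) by (simp_all cong: measurable_cong_sets add: measurable_cong_sets[OF refl sets_mu])
    interpret p: prob_space \<pi> by (rule marg(6))
    let ?d = "\<lambda>p. S (fst p) - snd p"
    have "ennreal (cost S) + (\<integral>\<^sup>+p. ennreal ((norm (?d p))\<^sup>2) \<partial>\<pi>) \<le> ennreal (cost S + \<delta>\<^sup>2)"
      using coupling_cost_lower_bound[OF \<pi>(1) \<eta>] \<pi>(2) by (meson less_imp_le order_trans)
    also have "\<dots> = ennreal (cost S) + ennreal (\<delta>\<^sup>2)" using cost_nonneg by (intro ennreal_plus) auto
    finally have d2: "(\<integral>\<^sup>+p. ennreal ((norm (?d p))\<^sup>2) \<partial>\<pi>) \<le> ennreal (\<delta>\<^sup>2)"
      by (simp add: ennreal_add_left_cancel_le)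
    have d_sq: "square_integrable \<pi> ?d"
      using d2 by (intro square_integrableI_nn_integral) (auto intro: order.strict_trans1)
    have d2': "(\<integral>p. (norm (?d p))\<^sup>2 \<partial>\<pi>) \<le> \<delta>\<^sup>2"
      using d2 unfolding nn_integral_norm_square[OF d_sq] by simp
    have i: "integrable \<pi> (\<lambda>p. norm (?d p))"
      by (intro integrable_norm p.square_integrable_imp_integrable d_sq)
    have "2 * \<delta> * (\<integral>p. norm (?d p) \<partial>\<pi>) = (\<integral>p. 2 * \<delta> * norm (?d p) \<partial>\<pi>)" by simp
    also have "\<dots> \<le> (\<integral>p. \<delta>\<^sup>2 + (norm (?d p))\<^sup>2 \<partial>\<pi>)"
      using i by (intro integral_mono sum_squares_bound Bochner_Integration.integrable_add
          square_integrable_norm_square[OF d_sq] integrable_mult_right) simp_all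
    also have "\<dots> = \<delta>\<^sup>2 + (\<integral>p. (norm (?d p))\<^sup>2 \<partial>\<pi>)"
      using square_integrable_norm_square[OF d_sq]
      by (subst Bochner_Integration.integral_add) (auto simp: p.prob_space)
    also have "\<dots> \<le> 2 * \<delta> * \<delta>" using d2' by (simp add: power2_eq_square)
    finally have d1: "(\<integral>p. norm (?d p) \<partial>\<pi>) \<le> \<delta>"
      by (rule mult_left_le_imp_le) (use \<delta> in simp)
    have f_int: "integrable \<pi> (\<lambda>p. ?f (snd p))" "integrable \<pi> (\<lambda>p. ?f (S (fst p)))"
      by (rule p.integrable_const_bound[where B=1]; measurable?; intro AE_I2; simp add: infdist_nonneg)+
    have "(\<integral>z. ?f z \<partial>\<eta>) = (\<integral>p. ?f (snd p) \<partial>\<pi>)"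
      using integral_distr[OF marg(3) f_meas] unfolding marg(5) .
    moreover have "(\<integral>z. ?f z \<partial>distr \<mu> borel S) = (\<integral>p. ?f (S (fst p)) \<partial>\<pi>)"
    proof -
      have "(\<lambda>x. ?f (S x)) \<in> borel_measurable \<mu>" by measurable
      from integral_distr[OF marg(2) this] have "(\<integral>x. ?f (S x) \<partial>\<mu>) = (\<integral>p. ?f (S (fst p)) \<partial>\<pi>)"
        unfolding marg(4) .
      moreover have "(\<integral>z. ?f z \<partial>distr \<mu> borel S) = (\<integral>x. ?f (S x) \<partial>\<mu>)"
        by (intro integral_distr f_meas) measurable
      ultimately show ?thesis by (rule trans[rotated])
    qed
    ultimately have "\<bar>(\<integral>z. ?f z \<partial>\<eta>) - (\<integral>z. ?f z \<partial>distr \<mu> borel S)\<bar>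
        = norm (\<integral>p. ?f (snd p) - ?f (S (fst p)) \<partial>\<pi>)"
      using f_int by simp
    also have "\<dots> \<le> (\<integral>p. norm (?f (snd p) - ?f (S (fst p))) \<partial>\<pi>)" by (rule integral_norm_bound)
    also have "\<dots> \<le> (\<integral>p. real n * norm (?d p) \<partial>\<pi>)"
    proof (rule integral_mono)
      show "integrable \<pi> (\<lambda>p. norm (?f (snd p) - ?f (S (fst p))))"
        by (intro integrable_norm Bochner_Integration.integrable_diff f_int)
      show "norm (?f (snd p) - ?f (S (fst p))) \<le> real n * norm (?d p)" for p
        using f_lip[of "snd p" "S (fst p)"] by (simp only: real_norm_def norm_minus_commute)
    qed (use i in simp)
    also have "\<dots> \<le> real n * \<delta>" using d1 by (simp add: mult_left_mono)
    finally show ?thesis .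
  qed
  have "\<bar>(\<integral>z. ?f z \<partial>\<eta>) - (\<integral>z. ?f z \<partial>distr \<mu> borel S)\<bar> \<le> 0"
  proof (rule field_le_epsilon)
    fix e :: real assume "0 < e"
    have "real n * (e / (real n + 1)) \<le> e" using \<open>0 < e\<close> by (simp add: field_simps)
    then show "\<bar>(\<integral>z. ?f z \<partial>\<eta>) - (\<integral>z. ?f z \<partial>distr \<mu> borel S)\<bar> \<le> 0 + e"
      using close[of "e / (real n + 1)"] \<open>0 < e\<close> by simp
  qed
  then show "(\<integral>z. ?f z \<partial>\<eta>) = (\<integral>z. ?f z \<partial>distr \<mu> borel S)" by simp
qed simp

text \<open>
The lower bound for couplings, applied to the graph of the barycentre map of \<open>q\<close>.
\<close>
lemma kernel_cost_lower_bound: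
  assumes q: "q \<in> transport_kernels X Y \<mu> \<nu>"
  obtains T where "T \<in> borel_measurable borel" "AE x in \<mu>. (\<integral>y. y \<partial>q x) = T x"
    "kernel_cost c2 \<mu> q = 1/2 * (\<integral>\<^sup>+x. ennreal ((norm (x - T x))\<^sup>2) \<partial>\<mu>)"
    "ennreal (cost S) + (\<integral>\<^sup>+x. ennreal ((norm (S x - T x))\<^sup>2) \<partial>\<mu>)
      \<le> (\<integral>\<^sup>+x. ennreal ((norm (x - T x))\<^sup>2) \<partial>\<mu>)"
proof -
  interpret borel_kernel "\<lambda>x. if x \<in> X then q x else null_measure borel" \<mu> \<nu> Y
    by (rule borel_kernel_extension[OF q])
  define T where "T x = (\<integral>y. y \<partial>(if x \<in> X then q x else null_measure borel))" for x
  have T [measurable]: "T \<in> borel_measurable borel" unfolding T_def by (rule measurable_kernel_barycentre)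
  have eq: "AE x in \<mu>. (\<integral>y. y \<partial>q x) = T x"
    using AE_mu by eventually_elim (simp add: T_def)
  have phc: "le_phc (distr \<mu> borel T) \<nu>"
    using le_phc_distr_kernel_barycentre unfolding T_def .
  have "kernel_cost c2 \<mu> q = (\<integral>\<^sup>+x. ennreal (1/2 * (norm (x - T x))\<^sup>2) \<partial>\<mu>)"
    unfolding kernel_cost_def c2_def by (rule nn_integral_cong_AE) (use eq in eventually_elim, simp)
  also have "\<dots> = 1/2 * (\<integral>\<^sup>+x. ennreal ((norm (x - T x))\<^sup>2) \<partial>\<mu>)"
    unfolding half_ennreal by (rule nn_integral_cmult) measurable
  finally have cost: "kernel_cost c2 \<mu> q = 1/2 * (\<integral>\<^sup>+x. ennreal ((norm (x - T x))\<^sup>2) \<partial>\<mu>)" .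
  have m: "(\<lambda>p. ennreal ((norm (S (fst p) - snd p))\<^sup>2)) \<in> borel_measurable (borel :: ('a \<times> 'a) measure)"
    unfolding borel_prod[symmetric] by measurable
  show ?thesis
    using that[OF T eq cost] coupling_cost_lower_bound[OF graph_coupling(1)[OF T] phc]
    unfolding graph_coupling(2)[OF T m] graph_coupling(2)[OF T borel_measurable_dist_square] by simp
qed

lemma optimal_cost_eq: "optimal_cost c2 X Y \<mu> \<nu> = 1/2 * ennreal (cost S)"
proof (rule antisym)
  show "1/2 * ennreal (cost S) \<le> optimal_cost c2 X Y \<mu> \<nu>"
    unfolding optimal_cost_def
  proof (rule INF_greatest)
    fix q assume "q \<in> transport_kernels X Y \<mu> \<nu>"
    then obtain T where T: "kernel_cost c2 \<mu> q = 1/2 * (\<integral>\<^sup>+x. ennreal ((norm (x - T x))\<^sup>2) \<partial>\<mu>)"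
      "ennreal (cost S) + (\<integral>\<^sup>+x. ennreal ((norm (S x - T x))\<^sup>2) \<partial>\<mu>)
        \<le> (\<integral>\<^sup>+x. ennreal ((norm (x - T x))\<^sup>2) \<partial>\<mu>)"
      by (rule kernel_cost_lower_bound)
    have "ennreal (cost S) \<le> (\<integral>\<^sup>+x. ennreal ((norm (x - T x))\<^sup>2) \<partial>\<mu>)"
      using T(2) by (rule order_trans[rotated]) simp
    then show "1/2 * ennreal (cost S) \<le> kernel_cost c2 \<mu> q"
      unfolding T(1) by (rule mult_left_mono) simp
  qed
  show "optimal_cost c2 X Y \<mu> \<nu> \<le> 1/2 * ennreal (cost S)"
  proof (rule ennreal_le_epsilon)
    fix e :: real assume e: "0 < e"
    obtain h where h: "h \<in> densities" "cost (barycentre h) < cost S + e" using cost_approx[OF e] by blast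
    let ?q = "\<lambda>x. density \<nu> (\<lambda>y. ennreal (h x y))"
    have sq: "square_integrable \<mu> (\<lambda>x. x - barycentre h x)"
      by (intro square_integrable_diff square_integrable_id square_integrable_barycentre h(1))
    have "optimal_cost c2 X Y \<mu> \<nu> \<le> kernel_cost c2 \<mu> ?q"
      unfolding optimal_cost_def by (intro INF_lower density_transport_kernel(1) h(1))
    also have "\<dots> = (\<integral>\<^sup>+x. ennreal (1/2 * (norm (x - barycentre h x))\<^sup>2) \<partial>\<mu>)"
      unfolding kernel_cost_def c2_def density_transport_kernel(2)[OF h(1)] ..
    also have "\<dots> = ennreal (\<integral>x. 1/2 * (norm (x - barycentre h x))\<^sup>2 \<partial>\<mu>)"
      using square_integrable_norm_square[OF sq] by (intro nn_integral_eq_integral integrable_mult_right) auto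
    also have "\<dots> = ennreal (1/2 * cost (barycentre h))" by (simp add: cost_def)
    also have "\<dots> \<le> ennreal (1/2 * cost S + e)" using h(2) e by (intro ennreal_leI) simp
    also have "\<dots> = 1/2 * ennreal (cost S) + ennreal e"
      unfolding half_ennreal[symmetric] using e cost_nonneg[of S] by (intro ennreal_plus) auto
    finally show "optimal_cost c2 X Y \<mu> \<nu> \<le> 1/2 * ennreal (cost S) + ennreal e" .
  qed
qed

lemma minimizing_kernel_barycentre:
  assumes "minimizing_kernel c2 X Y \<mu> \<nu> q"
  shows "AE x in \<mu>. (\<integral>y. y \<partial>q x) = S x"
proof -
  have q: "q \<in> transport_kernels X Y \<mu> \<nu>" and "kernel_cost c2 \<mu> q = 1/2 * ennreal (cost S)"
    using assms by (auto simp: minimizing_kernel_def optimal_cost_eq)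
  then obtain T where [measurable]: "T \<in> borel_measurable borel" and T: "AE x in \<mu>. (\<integral>y. y \<partial>q x) = T x"
    "ennreal (cost S) = (\<integral>\<^sup>+x. ennreal ((norm (x - T x))\<^sup>2) \<partial>\<mu>)"
    "ennreal (cost S) + (\<integral>\<^sup>+x. ennreal ((norm (S x - T x))\<^sup>2) \<partial>\<mu>)
      \<le> (\<integral>\<^sup>+x. ennreal ((norm (x - T x))\<^sup>2) \<partial>\<mu>)"
    by (elim kernel_cost_lower_bound) (simp only: half_ennreal_cancel)
  have "ennreal (cost S) + (\<integral>\<^sup>+x. ennreal ((norm (S x - T x))\<^sup>2) \<partial>\<mu>) \<le> ennreal (cost S) + 0"
    using T(3) unfolding T(2)[symmetric] by simp
  then have "(\<integral>\<^sup>+x. ennreal ((norm (S x - T x))\<^sup>2) \<partial>\<mu>) = 0"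
    unfolding ennreal_add_left_cancel_le by simp
  then have "AE x in \<mu>. ennreal ((norm (S x - T x))\<^sup>2) = 0"
    by (subst (asm) nn_integral_0_iff_AE) auto
  with T(1) show ?thesis by eventually_elim (simp add: ennreal_eq_0_iff)
qed

end

section \<open>The projection theorem\<close>

theorem theorem5p7:
  fixes X Y :: "(real ^ 'n) set" and \<mu> \<nu> :: "(real ^ 'n) measure"
  assumes "compact X" and "compact Y"
    and "\<mu> \<in> borel_prob_on X" and "\<nu> \<in> borel_prob_on Y"
    and "0 \<notin> convex hull (measure_support \<nu>)"
  shows "(\<exists>!nubar. nubar \<in> borel_prob_on (conical_hull Y) \<and> le_phc nubar \<nu> \<and>
            optimal_cost c2 X Y \<mu> \<nu> = 1/2 * (INF \<eta>\<in>{\<eta>. le_phc \<eta> \<nu>}. W2_sq \<mu> \<eta>) \<and>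
            1/2 * (INF \<eta>\<in>{\<eta>. le_phc \<eta> \<nu>}. W2_sq \<mu> \<eta>) = 1/2 * W2_sq \<mu> nubar) \<and>
         (\<exists>C. closed C \<and> convex C \<and> C \<noteq> {} \<and>
            (\<forall>q. minimizing_kernel c2 X Y \<mu> \<nu> q \<longrightarrow>
               (AE x in \<mu>. (\<integral>y. y \<partial>(q x)) = x - closest_point C x)) \<and>
            (\<forall>nubar. nubar \<in> borel_prob_on (conical_hull Y) \<and> le_phc nubar \<nu> \<and>
               optimal_cost c2 X Y \<mu> \<nu> = 1/2 * (INF \<eta>\<in>{\<eta>. le_phc \<eta> \<nu>}. W2_sq \<mu> \<eta>) \<and>
               1/2 * (INF \<eta>\<in>{\<eta>. le_phc \<eta> \<nu>}. W2_sq \<mu> \<eta>) = 1/2 * W2_sq \<mu> nubar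
               \<longrightarrow> nubar = distr \<mu> borel (\<lambda>x. x - closest_point C x)))"
proof -
  interpret compact_marginals X Y \<mu> \<nu> using assms(1-4) by unfold_locales
  obtain S where "S \<in> borel_measurable borel" "square_integrable \<mu> S"
    "\<And>e. 0 < e \<Longrightarrow> \<exists>h\<in>densities. cost (barycentre h) < cost S + e"
    "\<And>h. h \<in> densities \<Longrightarrow> (\<integral>x. (x - S x) \<bullet> (barycentre h x - S x) \<partial>\<mu>) \<le> 0"
    "\<And>\<phi>. sublinear \<phi> \<Longrightarrow> (\<integral>x. \<phi> (S x) \<partial>\<mu>) \<le> (\<integral>y. \<phi> y \<partial>\<nu>)"
    by (rule ex_optimal_barycentre) blast
  then interpret optimal_barycentre X Y \<mu> \<nu> S by unfold_locales
  obtain c where "AE x in \<mu>. x - S x \<in> closure (range (c :: nat \<Rightarrow> real ^ 'n))"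
    "\<And>k. (\<integral>y. max_inner c k y \<partial>\<nu>) \<le> (\<integral>x. (x - S x) \<bullet> S x \<partial>\<mu>)"
    by (rule ex_potential) blast
  then interpret optimal_potential X Y \<mu> \<nu> S c by unfold_locales
  let ?nubar = "distr \<mu> borel S"
  let ?P = "\<lambda>nubar. nubar \<in> borel_prob_on (conical_hull Y) \<and> le_phc nubar \<nu> \<and>
    optimal_cost c2 X Y \<mu> \<nu> = 1/2 * (INF \<eta>\<in>{\<eta>. le_phc \<eta> \<nu>}. W2_sq \<mu> \<eta>) \<and>
    1/2 * (INF \<eta>\<in>{\<eta>. le_phc \<eta> \<nu>}. W2_sq \<mu> \<eta>) = 1/2 * W2_sq \<mu> nubar"
  have W: "W2_sq \<mu> ?nubar = ennreal (cost S)"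
    by (rule antisym[OF W2_sq_S W2_sq_lower_bound[OF le_phc_S]])
  have on: "?nubar \<in> borel_prob_on (conical_hull Y)"
    unfolding borel_prob_on_def
    using AE_in_conical_hull_of_le_phc[OF le_phc_S compact_Y AE_nu assms(5)] mu.prob_space_distr[of S borel]
    by auto
  have ex: "?P ?nubar"
    using on le_phc_S by (simp only: optimal_cost_eq INF_W2_sq W)
  have unique: "nubar = ?nubar" if "?P nubar" for nubar
    using that by (intro le_phc_optimal_unique) (simp_all only: INF_W2_sq half_ennreal_cancel)
  have proj: "?nubar = distr \<mu> borel (\<lambda>x. x - closest_point C x)"
  proof (rule distr_cong_AE)
    have "continuous_on UNIV (closest_point C)"
      by (rule continuous_on_closest_point[OF C_convex C_closed C_nonempty])
    then have [measurable]: "closest_point C \<in> borel_measurable borel"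
      by (rule borel_measurable_continuous_onI)
    show "(\<lambda>x. x - closest_point C x) \<in> measurable \<mu> borel" by measurable
    show "S \<in> measurable \<mu> borel" by measurable
  qed (simp_all add: residual_eq_projection)
  have means: "AE x in \<mu>. (\<integral>y. y \<partial>(q x)) = x - closest_point C x"
    if "minimizing_kernel c2 X Y \<mu> \<nu> q" for q
    using minimizing_kernel_barycentre[OF that] residual_eq_projection by eventually_elim simp
  have "\<exists>!nubar. ?P nubar" using ex unique by (rule ex1I)
  moreover have "\<forall>nubar. ?P nubar \<longrightarrow> nubar = distr \<mu> borel (\<lambda>x. x - closest_point C x)"
    using unique unfolding proj by blast
  ultimately show ?thesis using C_closed C_convex C_nonempty means by blast
qed

end
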